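(* For each $N$ let $J=J_N\in\mathbb{R}^{N\times N}$ be a symmetric matrix with zero entries on the diagonal. Fix $\beta_0>0$ and $h_0\in\mathbb{R}$, and for each $N$ let $\tau\in\{-1,+1\}^N$ be a sample drawn from the Gibbs measure $P_{\beta_0,h_0}$ associated to $J_N$. Assume that: (i) $\|J_N\|=O(1)$, i.e. $\sup_N\|J_N\|<\infty$, where $\|\cdot\|$ is the operator norm; (ii) under $P_{\beta_0,h_0}$, $\widetilde T_N(\beta_0,h_0|\tau)=\Omega_p(1)$, i.e. for every $\epsilon>0$ there exists $c>0$ such that $P_{\beta_0,h_0}\bigl(\widetilde T_N(\beta_0,h_0|\tau)\ge c\bigr)\ge 1-\epsilon$ for all sufficiently large $N$. Then, with $P_{\beta_0,h_0}$-probability tending to one as $N\to\infty$, the maximum pseudolikelihood estimator exists, i.e. the bivariate equation $$(S(\beta,h|\tau),\,Q(\beta,h|\tau))=(0,0)$$ has a unique solution $(\hat\beta(\tau),\hat h(\tau))\in\mathbb{R}^2$. Moreover, $(\hat\beta(\tau),\hat h(\tau))$ is a $\sqrt N$-consistent estimator of $(\beta_0,h_0)$: under $P_{\beta_0,h_0}$, $$\|(\hat\beta(\tau)-\beta_0,\hat h(\tau)-h_0)\|_2=O_p(N^{-1/2}),$$ i.e. for every $\epsilon>0$ there exists $M<\infty$ such that for all sufficiently large $N$, with $P_{\beta_0,h_0}$-probability at least $1-\epsilon$, the unique solution exists and satisfies $\|(\hat\beta(\tau)-\beta_0,\hat h(\tau)-h_0)\|_2\le M N^{-1/2}$.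
   Context: For a real symmetric $N\times N$ matrix $J$ with zero diagonal, $\beta>0$ and $h\in\mathbb{R}$, the Gibbs measure on $\{-1,+1\}^N$ is $$P_{\beta,h}(\sigma)=\frac{\exp\bigl(\tfrac{\beta}{2}\langle J\sigma,\sigma\rangle+h\sum_{i=1}^N\sigma_i\bigr)}{Z_N(\beta,h)},$$ where $Z_N(\beta,h)$ is the normalizing constant. For $\sigma\in\{-1,+1\}^N$ the local fields are $m_i(\sigma)=\sum_{j=1}^N J_{ij}\sigma_j$, $i\in[N]=\{1,\dots,N\}$. The score functions (partial derivatives in $\beta$ and $h$ of the log-pseudolikelihood $\log\prod_i P_{\beta,h}(\sigma_i|\sigma_j, j\ne i)$) are, for $(\beta,h)\in\mathbb{R}^2$, $$S(\beta,h|\sigma)=\sum_{i=1}^N m_i(\sigma)\bigl(\sigma_i-\tanh(\beta m_i(\sigma)+h)\bigr),\qquad Q(\beta,h|\sigma)=\sum_{i=1}^N\bigl(\sigma_i-\tanh(\beta m_i(\sigma)+h)\bigr).$$ Let $\theta_i(\beta,h|\sigma)=\operatorname{sech}^2(\beta m_i(\sigma)+h)$ and $$\widetilde T_N(\beta,h|\sigma)=\frac1{N^2}\sum_{i,j\in[N]}\theta_i(\beta,h|\sigma)\,\theta_j(\beta,h|\sigma)\,(m_i(\sigma)-m_j(\sigma))^2.$$ *)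

theory Defs
  imports "HOL-Probability.Probability"
begin

text \<open>
  The size \<open>N\<close> varies inside the statement, so \<open>N \<times> N\<close> matrices and vectors of length \<open>N\<close> are
  functions on indices, of which only the values on \<open>{1..N}\<close> are used.
\<close>

definition configs :: "nat \<Rightarrow> (nat \<Rightarrow> real) set" where
  "configs N = {1..N} \<rightarrow>\<^sub>E {-1, 1}"

definition op_norm :: "nat \<Rightarrow> (nat \<Rightarrow> nat \<Rightarrow> real) \<Rightarrow> real" where
  "op_norm N A =
     (SUP x\<in>{x :: nat \<Rightarrow> real. L2_set x {1..N} \<le> 1}. L2_set (\<lambda>i. \<Sum>j=1..N. A i j * x j) {1..N})"

definition local_field :: "nat \<Rightarrow> (nat \<Rightarrow> nat \<Rightarrow> real) \<Rightarrow> (nat \<Rightarrow> real) \<Rightarrow> nat \<Rightarrow> real" where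
  "local_field N A \<sigma> i = (\<Sum>j=1..N. A i j * \<sigma> j)"

definition gibbs_weight ::
    "nat \<Rightarrow> (nat \<Rightarrow> nat \<Rightarrow> real) \<Rightarrow> real \<Rightarrow> real \<Rightarrow> (nat \<Rightarrow> real) \<Rightarrow> real" where
  "gibbs_weight N A \<beta> h \<sigma> =
     exp (\<beta> / 2 * (\<Sum>i=1..N. (\<Sum>j=1..N. A i j * \<sigma> j) * \<sigma> i) + h * (\<Sum>i=1..N. \<sigma> i))"

definition partition_function ::
    "nat \<Rightarrow> (nat \<Rightarrow> nat \<Rightarrow> real) \<Rightarrow> real \<Rightarrow> real \<Rightarrow> real" where
  "partition_function N A \<beta> h = (\<Sum>\<sigma>\<in>configs N. gibbs_weight N A \<beta> h \<sigma>)"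

definition gibbs ::
    "nat \<Rightarrow> (nat \<Rightarrow> nat \<Rightarrow> real) \<Rightarrow> real \<Rightarrow> real \<Rightarrow> (nat \<Rightarrow> real) measure" where
  "gibbs N A \<beta> h =
     point_measure (configs N) (\<lambda>\<sigma>. ennreal (gibbs_weight N A \<beta> h \<sigma> / partition_function N A \<beta> h))"

definition score_S ::
    "nat \<Rightarrow> (nat \<Rightarrow> nat \<Rightarrow> real) \<Rightarrow> (nat \<Rightarrow> real) \<Rightarrow> real \<Rightarrow> real \<Rightarrow> real" where
  "score_S N A \<sigma> \<beta> h =
     (\<Sum>i=1..N. local_field N A \<sigma> i * (\<sigma> i - tanh (\<beta> * local_field N A \<sigma> i + h)))"

definition score_Q ::
    "nat \<Rightarrow> (nat \<Rightarrow> nat \<Rightarrow> real) \<Rightarrow> (nat \<Rightarrow> real) \<Rightarrow> real \<Rightarrow> real \<Rightarrow> real" where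
  "score_Q N A \<sigma> \<beta> h =
     (\<Sum>i=1..N. (\<sigma> i - tanh (\<beta> * local_field N A \<sigma> i + h)))"

text \<open>The square of the hyperbolic secant.\<close>

definition theta ::
    "nat \<Rightarrow> (nat \<Rightarrow> nat \<Rightarrow> real) \<Rightarrow> (nat \<Rightarrow> real) \<Rightarrow> real \<Rightarrow> real \<Rightarrow> nat \<Rightarrow> real" where
  "theta N A \<sigma> \<beta> h i = (1 / cosh (\<beta> * local_field N A \<sigma> i + h))\<^sup>2"

definition T_tilde ::
    "nat \<Rightarrow> (nat \<Rightarrow> nat \<Rightarrow> real) \<Rightarrow> (nat \<Rightarrow> real) \<Rightarrow> real \<Rightarrow> real \<Rightarrow> real" where
  "T_tilde N A \<sigma> \<beta> h =
     1 / (real N)\<^sup>2 *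
     (\<Sum>i=1..N. \<Sum>j=1..N. theta N A \<sigma> \<beta> h i * theta N A \<sigma> \<beta> h j *
        (local_field N A \<sigma> i - local_field N A \<sigma> j)\<^sup>2)"

definition score_root ::
    "nat \<Rightarrow> (nat \<Rightarrow> nat \<Rightarrow> real) \<Rightarrow> (nat \<Rightarrow> real) \<Rightarrow> real \<times> real \<Rightarrow> bool" where
  "score_root N A \<sigma> = (\<lambda>(\<beta>, h). (score_S N A \<sigma> \<beta> h, score_Q N A \<sigma> \<beta> h) = (0, 0))"

definition mple_exists :: "nat \<Rightarrow> (nat \<Rightarrow> nat \<Rightarrow> real) \<Rightarrow> (nat \<Rightarrow> real) \<Rightarrow> bool" where
  "mple_exists N A \<sigma> \<longleftrightarrow> (\<exists>!p. score_root N A \<sigma> p)"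

text \<open>Only meaningful when \<^const>\<open>mple_exists\<close> holds.\<close>

definition mple :: "nat \<Rightarrow> (nat \<Rightarrow> nat \<Rightarrow> real) \<Rightarrow> (nat \<Rightarrow> real) \<Rightarrow> real \<times> real" where
  "mple N A \<sigma> = (THE p. score_root N A \<sigma> p)"

end

theory Submission
  imports Defs
begin

text \<open>
  The scores \<open>(S, Q)\<close> form the gradient of the log-pseudolikelihood, which is concave in \<open>(\<beta>, h)\<close>.  The
  proof shows that at \<open>(\<beta>\<^sub>0, h\<^sub>0)\<close> this gradient is of order \<open>\<surd>N\<close> with high probability, while within
  distance of order \<open>1 / \<surd>N\<close> the function is strongly concave with a constant of order \<open>N\<close>.  The
  maximizer is then within distance of order \<open>1 / \<surd>N\<close> of \<open>(\<beta>\<^sub>0, h\<^sub>0)\<close>.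

  Size of the gradient (\<open>score_second_moment\<close>): given the other spins, \<open>\<sigma>\<^sub>i\<close> has mean
  \<open>tanh (\<beta>\<^sub>0 m\<^sub>i + h\<^sub>0)\<close>, so the residual at \<open>i\<close> times the Gibbs weight is antisymmetric under the flip of the
  spin at \<open>i\<close>.  Hence the second moment of a score is half the mean of the sum over \<open>i\<close> of its \<open>i\<close>-th
  summand times its change under the flip at \<open>i\<close>.  A flip at \<open>i\<close> moves the local fields by a multiple
  of the \<open>i\<close>-th column of the matrix; after linearising, the operator norm bounds the resulting
  bilinear form, and the square sums of the columns bound the remainder.

  Strong concavity (\<open>information_form_lower\<close>, \<open>score_decrease\<close>): the Hessian at \<open>(\<beta>\<^sub>0, h\<^sub>0)\<close> is minus
  the matrix \<open>\<Sum>\<^sub>i \<theta>\<^sub>i (m\<^sub>i, 1) (m\<^sub>i, 1)\<^sup>T\<close>, whose determinant is \<open>N\<^sup>2 T / 2\<close> with \<open>T\<close> the quantity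
  \<^const>\<open>T_tilde\<close>, and whose trace is of order \<open>N\<close>.  So its least eigenvalue is at least a multiple of
  \<open>N\<close> once \<open>T\<close> is bounded below.  Moving away by \<open>r\<close> costs a cubic error \<open>r\<^sup>3 \<Sum>\<^sub>i \<theta>\<^sub>i (\<bar>m\<^sub>i\<bar> + 1)\<^sup>3\<close>, which is
  of order \<open>N r\<^sup>3\<close> because \<open>\<beta>\<^sub>0 > 0\<close> makes \<open>\<theta>\<^sub>i\<close> decay exponentially in \<open>\<bar>m\<^sub>i\<bar>\<close>; for \<open>r = M / \<surd>N\<close> this is
  negligible against \<open>N r\<^sup>2\<close>, and \<open>M\<close> may be as large as needed.

  Consequently the gradient of the log-pseudolikelihood points inwards on the circle of radius
  \<open>M / \<surd>N\<close> around \<open>(\<beta>\<^sub>0, h\<^sub>0)\<close>, so that a critical point exists inside (\<open>score_root_in_disc\<close>).  It is unique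
  by strict concavity, as \<open>T > 0\<close> forces two different local fields (\<open>score_root_unique\<close>).
\<close>

section \<open>Elementary estimates for the hyperbolic functions\<close>

lemma sech_sq_eq: "(1 / cosh x)\<^sup>2 = 1 - (tanh x)\<^sup>2" for x :: real
proof -
  have "1 - (tanh x)\<^sup>2 = ((cosh x)\<^sup>2 - (sinh x)\<^sup>2) / (cosh x)\<^sup>2"
    by (simp add: tanh_def power_divide diff_divide_distrib)
  also have "(cosh x)\<^sup>2 - (sinh x)\<^sup>2 = 1"
    by (simp add: cosh_square_eq)
  finally show ?thesis
    by (simp add: power_divide)
qed

lemma abs_tanh_le_1: "\<bar>tanh x\<bar> \<le> 1" for x :: real
  using tanh_real_lt_1[of x] tanh_real_gt_neg1[of x] by linarith

lemma cosh_ge_half_exp_abs: "exp \<bar>x\<bar> / 2 \<le> cosh x" for x :: real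
  by (cases "x \<ge> 0") (auto simp: cosh_field_def)

lemma cube_le_exp:
  fixes z :: real
  assumes "z \<ge> 0"
  shows "z ^ 3 \<le> 27 * exp z"
proof -
  have "z / 3 \<le> exp (z / 3)"
    using exp_ge_add_one_self[of "z/3"] by linarith
  then have "(z / 3) ^ 3 \<le> exp (z / 3) ^ 3"
    using assms by (intro power_mono) auto
  also have "\<dots> = exp z"
    by (simp flip: exp_of_nat_mult)
  finally show ?thesis
    by (simp add: power_divide)
qed

text \<open>The exponential decay of \<open>sech\<^sup>2\<close>, available since \<open>\<beta> > 0\<close>.  The local fields are controlled only in
  mean square; every higher power of them below comes with a factor \<open>sech\<^sup>2\<close> and is bounded by \<open>B\<close>.\<close>

lemma sech_sq_times_cube_bounded:
  fixes \<beta> h :: real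
  assumes "\<beta> > 0"
  obtains B where "B > 0" "\<And>x. (1 / cosh (\<beta> * x + h))\<^sup>2 * (\<bar>x\<bar> + 1) ^ 3 \<le> B"
proof
  define B where "B = 108 / (2 * \<beta>) ^ 3 * exp (2 * \<beta> + 2 * \<bar>h\<bar>)"
  show "B > 0"
    using assms by (simp add: B_def)
  fix x :: real
  define y where "y = \<bar>x\<bar> + 1"
  have y: "\<beta> * y - \<beta> - \<bar>h\<bar> \<le> \<bar>\<beta> * x + h\<bar>"
    using assms abs_triangle_ineq2[of "\<beta> * x" "- h"]
    by (simp add: y_def abs_mult algebra_simps)
  have "exp (\<beta> * y - \<beta> - \<bar>h\<bar>) / 2 \<le> cosh (\<beta> * x + h)"
    using y by (intro order_trans[OF _ cosh_ge_half_exp_abs]) auto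
  then have "(1 / cosh (\<beta> * x + h))\<^sup>2 \<le> (1 / (exp (\<beta> * y - \<beta> - \<bar>h\<bar>) / 2))\<^sup>2"
    by (intro power_mono frac_le) auto
  also have "\<dots> = 4 * exp (- 2 * (\<beta> * y - \<beta> - \<bar>h\<bar>))"
    by (simp add: power_divide exp_minus field_simps power2_eq_square flip: exp_add)
  finally have 1: "(1 / cosh (\<beta> * x + h))\<^sup>2 \<le> 4 * exp (- 2 * (\<beta> * y - \<beta> - \<bar>h\<bar>))" .
  have "(2 * \<beta> * y) ^ 3 \<le> 27 * exp (2 * \<beta> * y)"
    using assms by (intro cube_le_exp) (auto simp: y_def)
  then have 2: "y ^ 3 \<le> 27 / (2 * \<beta>) ^ 3 * exp (2 * \<beta> * y)"
    using assms by (simp add: field_simps)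
  have "(1 / cosh (\<beta> * x + h))\<^sup>2 * y ^ 3
      \<le> 4 * exp (- 2 * (\<beta> * y - \<beta> - \<bar>h\<bar>)) * (27 / (2 * \<beta>) ^ 3 * exp (2 * \<beta> * y))"
    by (intro mult_mono 1 2) (auto simp: y_def)
  also have "\<dots> = 108 / (2 * \<beta>) ^ 3 * (exp (- 2 * (\<beta> * y - \<beta> - \<bar>h\<bar>)) * exp (2 * \<beta> * y))"
    by simp
  also have "exp (- 2 * (\<beta> * y - \<beta> - \<bar>h\<bar>)) * exp (2 * \<beta> * y) = exp (2 * \<beta> + 2 * \<bar>h\<bar>)"
    by (simp add: algebra_simps flip: exp_add)
  finally show "(1 / cosh (\<beta> * x + h))\<^sup>2 * (\<bar>x\<bar> + 1) ^ 3 \<le> B"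
    by (simp add: B_def y_def)
qed

lemma cosh_add_le: "cosh (x + d) \<le> cosh x * exp \<bar>d\<bar>" for x d :: real
proof -
  have "exp (x + d) \<le> exp x * exp \<bar>d\<bar>" "exp (- (x + d)) \<le> exp (- x) * exp \<bar>d\<bar>"
    by (auto simp flip: exp_add)
  then show ?thesis
    by (simp add: cosh_field_def field_simps)
qed

lemma square_le_mult_sinh: "d\<^sup>2 \<le> d * sinh d" for d :: real
proof -
  have pos: "t \<le> sinh t" if "t \<ge> 0" for t :: real
  proof -
    have "(\<lambda>t. sinh t - t) 0 \<le> (\<lambda>t. sinh t - t) t"
    proof (rule DERIV_nonneg_imp_nondecreasing[OF that])
      fix x :: real
      show "\<exists>y. ((\<lambda>t. sinh t - t) has_real_derivative y) (at x) \<and> 0 \<le> y"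
        by (rule exI[of _ "cosh x - 1"]) (auto intro!: derivative_eq_intros simp: cosh_real_ge_1)
    qed
    then show ?thesis by simp
  qed
  show ?thesis
  proof (cases "d \<ge> 0")
    case True
    then show ?thesis
      using pos[of d] by (simp add: power2_eq_square mult_left_mono)
  next
    case False
    then have "(- d) * (- d) \<le> (- d) * sinh (- d)"
      using pos[of "- d"] by (intro mult_left_mono) auto
    then show ?thesis
      by (simp add: power2_eq_square)
  qed
qed

text \<open>A quantitative form of the monotonicity of \<open>tanh\<close>: the increment over a step \<open>d\<close>, multiplied
  by \<open>d\<close>, is at least \<open>1 - \<bar>d\<bar>\<close> times what the linearisation at the base point gives.\<close>

lemma tanh_increment_lower:
  fixes x d :: real
  shows "(1 / cosh x)\<^sup>2 * d\<^sup>2 * (1 - \<bar>d\<bar>) \<le> (tanh (x + d) - tanh x) * d"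
proof -
  have "tanh (x + d) - tanh x = sinh d / (cosh (x + d) * cosh x)"
  proof -
    have "tanh (x + d) - tanh x = (sinh (x + d) * cosh x - cosh (x + d) * sinh x) / (cosh (x + d) * cosh x)"
      by (simp add: tanh_def field_simps)
    also have "sinh (x + d) * cosh x - cosh (x + d) * sinh x = sinh (x + d - x)"
      by (simp only: sinh_diff)
    finally show ?thesis by simp
  qed
  then have eq: "(tanh (x + d) - tanh x) * d = d * sinh d / (cosh (x + d) * cosh x)"
    by simp
  have "1 - \<bar>d\<bar> \<le> exp (- \<bar>d\<bar>)"
    using exp_ge_add_one_self[of "- \<bar>d\<bar>"] by simp
  then have "(1 / cosh x)\<^sup>2 * d\<^sup>2 * (1 - \<bar>d\<bar>) \<le> (1 / cosh x)\<^sup>2 * d\<^sup>2 * exp (- \<bar>d\<bar>)"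
    by (intro mult_left_mono) auto
  also have "\<dots> = d\<^sup>2 / ((cosh x * exp \<bar>d\<bar>) * cosh x)"
    by (simp add: exp_minus field_simps power2_eq_square)
  also have "\<dots> \<le> d * sinh d / (cosh (x + d) * cosh x)"
    using square_le_mult_sinh[of d] cosh_add_le[of x d]
    by (intro frac_le mult_right_mono mult_pos_pos) (auto intro: order_trans[OF zero_le_power2])
  finally show ?thesis
    using eq by simp
qed

text \<open>Uniform bounds on the derivative and on the first-order Taylor remainder of
  \<open>(a x + b) tanh (\<beta> x + h)\<close>.  They hold because \<open>\<beta> > 0\<close>: the factor \<open>sech\<^sup>2\<close> in the derivatives
  then absorbs the growth of \<open>a x + b\<close>.\<close>

lemma affine_tanh_taylor:
  fixes \<beta> h a b B :: real
  assumes "\<beta> > 0" and B: "\<And>x. (1 / cosh (\<beta> * x + h))\<^sup>2 * (\<bar>x\<bar> + 1) ^ 3 \<le> B"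
    and ab: "\<bar>a\<bar> \<le> 1" "\<bar>b\<bar> \<le> 1"
  defines "f \<equiv> \<lambda>x. (a * x + b) * tanh (\<beta> * x + h)"
  defines "f' \<equiv> \<lambda>x. a * tanh (\<beta> * x + h) + (a * x + b) * (\<beta> * (1 / cosh (\<beta> * x + h))\<^sup>2)"
  shows "\<bar>f' x\<bar> \<le> 1 + \<beta> * B"
    and "\<bar>f x - f y - f' y * (x - y)\<bar> \<le> (2 * \<beta> + 2 * \<beta>\<^sup>2) * B * (x - y)\<^sup>2"
proof -
  define t where "t = (\<lambda>x. tanh (\<beta> * x + h))"
  define q where "q = (\<lambda>x. (1 / cosh (\<beta> * x + h))\<^sup>2)"
  have q_eq: "q x = 1 - (t x)\<^sup>2" for x
    by (simp add: q_def t_def sech_sq_eq)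
  have q0: "0 \<le> q x" for x by (simp add: q_def)
  have t1: "\<bar>t x\<bar> \<le> 1" for x by (simp add: t_def abs_tanh_le_1)
  have qB: "q x * (\<bar>x\<bar> + 1) \<le> B" for x
  proof -
    have "q x * (\<bar>x\<bar> + 1) ^ 1 \<le> q x * (\<bar>x\<bar> + 1) ^ 3"
      by (intro mult_left_mono power_increasing q0) auto
    also have "\<dots> \<le> B" using B[of x] by (simp only: q_def)
    finally show ?thesis by simp
  qed
  have lin: "\<bar>a * x + b\<bar> \<le> \<bar>x\<bar> + 1" for x
  proof -
    have "\<bar>a * x\<bar> \<le> \<bar>x\<bar>"
      using ab by (simp add: abs_mult mult_left_le_one_le)
    with ab show ?thesis by linarith
  qed
  have lqB: "\<bar>a * x + b\<bar> * q x \<le> B" for x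
    using mult_right_mono[OF lin q0, of x x] qB[of x] by (simp add: mult.commute)
  have qB': "q x \<le> B" for x
    using mult_left_mono[OF _ q0, of 1 "\<bar>x\<bar> + 1" x] qB[of x] by simp
  have B0: "0 \<le> B" using qB'[of 0] q0[of 0] by linarith
  have t': "(t has_real_derivative \<beta> * q x) (at x)" for x
    unfolding t_def q_def sech_sq_eq by (auto intro!: derivative_eq_intros)
  have q': "(q has_real_derivative - 2 * \<beta> * t x * q x) (at x)" for x
  proof -
    have "q = (\<lambda>x. 1 - (t x)\<^sup>2)" by (simp add: fun_eq_iff q_eq)
    then show ?thesis
      by (auto intro!: derivative_eq_intros t' simp: q_eq)
  qed
  have f_eq: "f = (\<lambda>x. (a * x + b) * t x)" by (simp add: f_def t_def)
  have f'_eq: "f' = (\<lambda>x. a * t x + (a * x + b) * (\<beta> * q x))" by (simp add: f'_def t_def q_def)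
  define f'' where "f'' = (\<lambda>x. 2 * a * \<beta> * q x - 2 * \<beta>\<^sup>2 * t x * ((a * x + b) * q x))"
  have df: "(f has_real_derivative f' x) (at x)" for x
    unfolding f_eq f'_eq by (auto intro!: derivative_eq_intros t')
  have df': "(f' has_real_derivative f'' x) (at x)" for x
    unfolding f'_eq f''_def
    by (auto intro!: derivative_eq_intros t' q' simp: algebra_simps power2_eq_square)
  show "\<bar>f' x\<bar> \<le> 1 + \<beta> * B" for x
  proof -
    have "\<bar>a * t x\<bar> \<le> 1"
      using ab t1[of x] by (simp add: abs_mult mult_le_one)
    moreover have "\<bar>(a * x + b) * (\<beta> * q x)\<bar> \<le> \<beta> * B"
      using mult_left_mono[OF lqB[of x], of \<beta>] \<open>\<beta> > 0\<close> q0[of x]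
      by (simp add: abs_mult mult_ac)
    ultimately show ?thesis
      unfolding f'_eq by linarith
  qed
  define C where "C = (2 * \<beta> + 2 * \<beta>\<^sup>2) * B"
  have f''_le: "\<bar>f'' x\<bar> \<le> C" for x
  proof -
    have "\<bar>2 * a * \<beta> * q x\<bar> \<le> 2 * \<beta> * B"
    proof -
      have "\<bar>a\<bar> * q x \<le> 1 * B" using ab qB'[of x] q0[of x] by (intro mult_mono) auto
      then show ?thesis
        using \<open>\<beta> > 0\<close> q0[of x] by (simp add: abs_mult mult_ac)
    qed
    moreover have "\<bar>2 * \<beta>\<^sup>2 * t x * ((a * x + b) * q x)\<bar> \<le> 2 * \<beta>\<^sup>2 * B"
    proof -
      have "\<bar>t x\<bar> * (\<bar>a * x + b\<bar> * q x) \<le> 1 * B"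
        using t1[of x] lqB[of x] q0[of x] by (intro mult_mono) auto
      then show ?thesis
        using \<open>\<beta> > 0\<close> q0[of x] by (simp add: abs_mult mult_ac)
    qed
    ultimately show ?thesis
      unfolding f''_def C_def by (simp add: algebra_simps abs_le_iff)
  qed
  have C0: "0 \<le> C" using f''_le[of 0] by linarith
  have lip: "\<bar>f' z - f' y\<bar> \<le> C * \<bar>z - y\<bar>" for z y
  proof -
    have "norm (f' z - f' y) \<le> C * norm (z - y)"
      by (rule field_differentiable_bound[of UNIV f' f''])
        (use df' f''_le in \<open>auto intro: has_field_derivative_at_within\<close>)
    then show ?thesis by simp
  qed
  have "\<bar>f x - f y - f' y * (x - y)\<bar> \<le> C * (x - y)\<^sup>2"
  proof -
    \<comment> \<open>on the segment from \<open>y\<close> to \<open>x\<close> the function \<open>z \<mapsto> f z - f' y * z\<close> has slope at most \<open>C * \<bar>x - y\<bar>\<close>\<close>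
    have "norm ((\<lambda>z. f z - f' y * z) x - (\<lambda>z. f z - f' y * z) y) \<le> C * \<bar>x - y\<bar> * norm (x - y)"
    proof (rule field_differentiable_bound[of "closed_segment y x" _ "\<lambda>z. f' z - f' y"])
      fix z assume "z \<in> closed_segment y x"
      then have "\<bar>z - y\<bar> \<le> \<bar>x - y\<bar>"
        by (auto simp: closed_segment_eq_real_ivl split: if_splits)
      then show "norm (f' z - f' y) \<le> C * \<bar>x - y\<bar>"
        using lip[of z y] C0 mult_left_mono[of "\<bar>z - y\<bar>" "\<bar>x - y\<bar>" C] by simp
      show "((\<lambda>z. f z - f' y * z) has_field_derivative f' z - f' y) (at z within closed_segment y x)"
        by (auto intro!: derivative_eq_intros has_field_derivative_at_within[OF df])
    qed auto
    then show ?thesis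
      by (simp add: algebra_simps power2_eq_square flip: abs_mult)
  qed
  then show "\<bar>f x - f y - f' y * (x - y)\<bar> \<le> (2 * \<beta> + 2 * \<beta>\<^sup>2) * B * (x - y)\<^sup>2"
    by (simp add: C_def)
qed

section \<open>The operator norm of a matrix given by its entries\<close>

lemma matrix_vector_L2_le_op_norm:
  "L2_set (\<lambda>i. \<Sum>j=1..N. A i j * x j) {1..N} \<le> op_norm N A * L2_set x {1..N}"
proof -
  define y where "y = (\<lambda>x i. \<Sum>j=1..N. A i j * x j)"
  have bdd: "bdd_above ((\<lambda>x. L2_set (y x) {1..N}) ` {x. L2_set x {1..N} \<le> 1})"
  proof (rule bdd_aboveI2)
    fix x :: "nat \<Rightarrow> real" assume x: "x \<in> {x. L2_set x {1..N} \<le> 1}"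
    have "\<bar>y x i\<bar> \<le> L2_set (A i) {1..N} * 1" for i
    proof -
      have "\<bar>y x i\<bar> \<le> (\<Sum>j=1..N. \<bar>A i j\<bar> * \<bar>x j\<bar>)"
        unfolding y_def by (rule order_trans[OF sum_abs]) (simp add: abs_mult)
      also have "\<dots> \<le> L2_set (A i) {1..N} * L2_set x {1..N}"
        by (rule L2_set_mult_ineq)
      also have "\<dots> \<le> L2_set (A i) {1..N} * 1"
        using x by (intro mult_left_mono) auto
      finally show ?thesis .
    qed
    then show "L2_set (y x) {1..N} \<le> (\<Sum>i=1..N. L2_set (A i) {1..N} * 1)"
      by (intro order_trans[OF L2_set_le_sum_abs] sum_mono)
  qed
  show ?thesis
  proof (cases "L2_set x {1..N} = 0")
    case True
    then have "x j = 0" if "j \<in> {1..N}" for j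
      using that by (simp add: L2_set_eq_0_iff)
    then have "L2_set (y x) {1..N} = 0"
      by (intro L2_set_0') (auto simp: y_def intro!: sum.neutral)
    with True show ?thesis
      by (simp add: y_def)
  next
    case False
    define r where "r = L2_set x {1..N}"
    have r: "r > 0"
      using False by (simp add: r_def less_le)
    have scale: "L2_set (\<lambda>j. v j / r) {1..N} = L2_set v {1..N} / r" for v
      using L2_set_right_distrib[of "1/r" v "{1..N}"] r by simp
    have op_norm_eq: "op_norm N A = (SUP x\<in>{x. L2_set x {1..N} \<le> 1}. L2_set (y x) {1..N})"
      by (simp add: op_norm_def y_def)
    have "L2_set (y (\<lambda>j. x j / r)) {1..N} \<le> op_norm N A"
      unfolding op_norm_eq
    proof (rule cSUP_upper[OF _ bdd])
      show "(\<lambda>j. x j / r) \<in> {x. L2_set x {1..N} \<le> 1}"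
        using r unfolding mem_Collect_eq scale r_def[symmetric] by simp
    qed
    moreover have "y (\<lambda>j. x j / r) = (\<lambda>i. y x i / r)"
      by (simp add: y_def sum_divide_distrib)
    ultimately have "L2_set (y x) {1..N} / r \<le> op_norm N A"
      by (simp only: scale)
    then show ?thesis
      using r by (simp add: y_def r_def field_simps)
  qed
qed

lemma matrix_vector_sum_squares_le:
  assumes "op_norm N A \<le> K"
  shows "(\<Sum>i=1..N. (\<Sum>j=1..N. A i j * x j)\<^sup>2) \<le> K\<^sup>2 * (\<Sum>j=1..N. (x j)\<^sup>2)"
proof -
  have "L2_set (\<lambda>i. \<Sum>j=1..N. A i j * x j) {1..N} \<le> K * L2_set x {1..N}"
    using matrix_vector_L2_le_op_norm[of A x N] mult_right_mono[OF assms, of "L2_set x {1..N}"]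
    by simp
  then have "(L2_set (\<lambda>i. \<Sum>j=1..N. A i j * x j) {1..N})\<^sup>2 \<le> (K * L2_set x {1..N})\<^sup>2"
    by (intro power_mono) auto
  then show ?thesis
    by (simp add: L2_set_def power_mult_distrib sum_nonneg)
qed

lemma sum_times_of_bool:
  fixes i N :: nat and g :: "nat \<Rightarrow> real"
  assumes "i \<in> {1..N}"
  shows "(\<Sum>j=1..N. g j * of_bool (j = i)) = g i"
  using assms by (simp add: of_bool_def if_distrib[of "\<lambda>t. _ * t"] cong: if_cong)

lemma column_sum_squares_le:
  assumes "op_norm N A \<le> K" and j: "j \<in> {1..N}"
  shows "(\<Sum>i=1..N. (A i j)\<^sup>2) \<le> K\<^sup>2"
proof -
  have "(\<Sum>k=1..N. A i k * of_bool (k = j)) = A i j" for i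
    by (rule sum_times_of_bool[OF j])
  moreover have "(\<Sum>k=1..N. (of_bool (k = j) :: real)\<^sup>2) = 1"
  proof -
    have "(\<Sum>k=1..N. (of_bool (k = j) :: real)\<^sup>2) = (\<Sum>k=1..N. if k = j then 1 else 0)"
      by (intro sum.cong) auto
    then show ?thesis using j by simp
  qed
  ultimately show ?thesis
    using matrix_vector_sum_squares_le[OF assms(1), of "\<lambda>k. of_bool (k = j)"] by simp
qed

section \<open>Spin flips and the Gibbs measure\<close>

lemma finite_configs [simp]: "finite (configs N)"
  by (simp add: configs_def finite_PiE)

lemma configs_nonempty: "configs N \<noteq> {}"
  by (simp add: configs_def PiE_eq_empty_iff)

lemma configsD: "\<sigma> \<in> configs N \<Longrightarrow> i \<in> {1..N} \<Longrightarrow> \<sigma> i = -1 \<or> \<sigma> i = 1"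
  by (auto simp: configs_def PiE_iff)

lemma config_square: "\<sigma> \<in> configs N \<Longrightarrow> i \<in> {1..N} \<Longrightarrow> (\<sigma> i)\<^sup>2 = 1"
  by (drule (1) configsD) auto

lemma config_abs: "\<sigma> \<in> configs N \<Longrightarrow> i \<in> {1..N} \<Longrightarrow> \<bar>\<sigma> i\<bar> = 1"
  by (drule (1) configsD) auto

text \<open>The configuration with the spin at site \<open>i\<close> reversed.\<close>

definition flip :: "nat \<Rightarrow> (nat \<Rightarrow> real) \<Rightarrow> nat \<Rightarrow> real" where
  "flip i \<sigma> = \<sigma>(i := - \<sigma> i)"

lemma flip_flip [simp]: "flip i (flip i \<sigma>) = \<sigma>"
  by (simp add: flip_def)

lemma flip_same [simp]: "flip i \<sigma> i = - \<sigma> i"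
  by (simp add: flip_def)

lemma flip_in_configs:
  assumes "\<sigma> \<in> configs N" "i \<in> {1..N}"
  shows "flip i \<sigma> \<in> configs N"
  using assms by (auto simp: flip_def configs_def PiE_iff extensional_def)

lemma sum_configs_flip:
  assumes "i \<in> {1..N}"
  shows "(\<Sum>\<sigma>\<in>configs N. F (flip i \<sigma>)) = (\<Sum>\<sigma>\<in>configs N. F \<sigma>)"
  by (rule sum.reindex_bij_witness[of _ "flip i" "flip i"]) (auto intro: flip_in_configs assms)

lemma flip_eq: "flip i \<sigma> j = \<sigma> j - 2 * \<sigma> i * of_bool (j = i)"
  by (simp add: flip_def)

lemma local_field_flip:
  assumes i: "i \<in> {1..N}"
  shows "local_field N A (flip i \<sigma>) j = local_field N A \<sigma> j - 2 * A j i * \<sigma> i"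
proof -
  have "local_field N A (flip i \<sigma>) j
      = local_field N A \<sigma> j - 2 * \<sigma> i * (\<Sum>k=1..N. A j k * of_bool (k = i))"
    unfolding local_field_def flip_eq right_diff_distrib sum_subtractf sum_distrib_left
    by (simp add: mult_ac)
  then show ?thesis
    unfolding sum_times_of_bool[OF i] by simp
qed

text \<open>The ratio of the weights of a configuration and its flip at \<open>i\<close>: the conditional law of the
  spin at \<open>i\<close> given the others is determined by the local field there.\<close>

lemma gibbs_weight_flip:
  assumes sym: "\<And>i j. i \<in> {1..N} \<Longrightarrow> j \<in> {1..N} \<Longrightarrow> A i j = A j i"
    and diag: "\<And>i. i \<in> {1..N} \<Longrightarrow> A i i = 0"
    and i: "i \<in> {1..N}"
  shows "gibbs_weight N A \<beta> h \<sigma>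
    = gibbs_weight N A \<beta> h (flip i \<sigma>) * exp (2 * \<sigma> i * (\<beta> * local_field N A \<sigma> i + h))"
proof -
  have quad: "(\<Sum>j=1..N. local_field N A (flip i \<sigma>) j * flip i \<sigma> j)
      = (\<Sum>j=1..N. local_field N A \<sigma> j * \<sigma> j) - 4 * \<sigma> i * local_field N A \<sigma> i"
  proof -
    have "(\<Sum>j=1..N. local_field N A (flip i \<sigma>) j * flip i \<sigma> j)
        = (\<Sum>j=1..N. local_field N A \<sigma> j * \<sigma> j - 2 * \<sigma> i * (A j i * \<sigma> j)
             - 2 * \<sigma> i * (local_field N A (flip i \<sigma>) j * of_bool (j = i)))"
      by (intro sum.cong refl) (simp only: local_field_flip[OF i], simp add: flip_eq algebra_simps)
    also have "\<dots> = (\<Sum>j=1..N. local_field N A \<sigma> j * \<sigma> j) - 2 * \<sigma> i * (\<Sum>j=1..N. A j i * \<sigma> j)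
        - 2 * \<sigma> i * local_field N A (flip i \<sigma>) i"
      by (simp only: sum_subtractf sum_distrib_left[symmetric] sum_times_of_bool[OF i])
    also have "(\<Sum>j=1..N. A j i * \<sigma> j) = local_field N A \<sigma> i"
      unfolding local_field_def by (intro sum.cong) (auto simp: sym[OF i])
    also have "local_field N A (flip i \<sigma>) i = local_field N A \<sigma> i"
      by (simp add: local_field_flip[OF i] diag[OF i])
    finally show ?thesis by simp
  qed
  have lin: "(\<Sum>j=1..N. flip i \<sigma> j) = (\<Sum>j=1..N. \<sigma> j) - 2 * \<sigma> i"
    using sum_times_of_bool[OF i, of "\<lambda>_. 1"]
    by (simp add: flip_eq sum_subtractf flip: sum_distrib_left)
  show ?thesis
    unfolding gibbs_weight_def local_field_def[symmetric] quad lin exp_add[symmetric]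
    by (simp add: algebra_simps)
qed

lemma gibbs_weight_pos: "gibbs_weight N A \<beta> h \<sigma> > 0"
  by (simp add: gibbs_weight_def)

lemma partition_function_pos: "partition_function N A \<beta> h > 0"
  unfolding partition_function_def
  by (intro sum_pos gibbs_weight_pos configs_nonempty) simp

lemma measure_gibbs:
  assumes "S \<subseteq> configs N"
  shows "measure (gibbs N A \<beta> h) S
    = (\<Sum>\<sigma>\<in>S. gibbs_weight N A \<beta> h \<sigma>) / partition_function N A \<beta> h"
  unfolding gibbs_def
  using assms by (subst measure_point_measure_finite_if)
    (auto simp: sum_divide_distrib intro!: divide_nonneg_nonneg
        less_imp_le[OF gibbs_weight_pos] less_imp_le[OF partition_function_pos])

section \<open>Second moments of the scores\<close>

text \<open>The residual at \<open>i\<close> has conditional mean zero given the other spins: its product with the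
  weight changes sign under a flip at \<open>i\<close>.\<close>

lemma gibbs_weight_residual_flip:
  assumes sym: "\<And>i j. i \<in> {1..N} \<Longrightarrow> j \<in> {1..N} \<Longrightarrow> A i j = A j i"
    and diag: "\<And>i. i \<in> {1..N} \<Longrightarrow> A i i = 0"
    and i: "i \<in> {1..N}" and \<sigma>: "\<sigma> \<in> configs N"
  shows "gibbs_weight N A \<beta> h (flip i \<sigma>) * (flip i \<sigma> i - tanh (\<beta> * local_field N A \<sigma> i + h))
    = - (gibbs_weight N A \<beta> h \<sigma> * (\<sigma> i - tanh (\<beta> * local_field N A \<sigma> i + h)))"
proof -
  define x where "x = \<beta> * local_field N A \<sigma> i + h"
  have w: "gibbs_weight N A \<beta> h \<sigma> = gibbs_weight N A \<beta> h (flip i \<sigma>) * exp (2 * \<sigma> i * x)"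
    unfolding x_def by (rule gibbs_weight_flip) fact+
  have "exp (2 * s * x) * (s - tanh x) = s + tanh x" if "s = -1 \<or> s = 1" for s :: real
  proof -
    have "exp x * (cosh x - sinh x) = exp (- x) * (cosh x + sinh x)"
      by (simp add: cosh_minus_sinh cosh_plus_sinh)
    then have "exp (2 * x) * (cosh x - sinh x) = cosh x + sinh x"
      by (simp add: cosh_minus_sinh cosh_plus_sinh flip: exp_add)
    moreover have "exp (- 2 * x) * (cosh x + sinh x) = cosh x - sinh x"
      by (simp add: cosh_minus_sinh cosh_plus_sinh flip: exp_add)
    ultimately show ?thesis
      using that unfolding tanh_def by (auto simp: field_simps)
  qed
  from this[OF configsD[OF \<sigma> i]]
  have "gibbs_weight N A \<beta> h (flip i \<sigma>) * (exp (2 * \<sigma> i * x) * (\<sigma> i - tanh x))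
      = gibbs_weight N A \<beta> h (flip i \<sigma>) * (\<sigma> i + tanh x)"
    by simp
  then show ?thesis
    unfolding w x_def[symmetric] by (simp add: algebra_simps)
qed

lemma sum_local_field_squares_le:
  assumes "op_norm N A \<le> K" and \<sigma>: "\<sigma> \<in> configs N"
  shows "(\<Sum>i=1..N. (local_field N A \<sigma> i)\<^sup>2) \<le> K\<^sup>2 * real N"
proof -
  have "(\<Sum>j=1..N. (\<sigma> j)\<^sup>2) = (\<Sum>j=1..N. 1)"
    by (intro sum.cong refl config_square[OF \<sigma>])
  then show ?thesis
    using matrix_vector_sum_squares_le[OF assms(1), of \<sigma>] by (simp add: local_field_def)
qed

text \<open>The effect of a single flip on a linear combination of the scores.  The two leading terms come
  from \<open>\<Sum>\<^sub>j (a m\<^sub>j + b) \<sigma>\<^sub>j\<close> and from the linearisation of \<open>\<Sum>\<^sub>j (a m\<^sub>j + b) tanh (\<beta> m\<^sub>j + h)\<close>; the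
  quadratic remainder is controlled by the square sum of a column of the matrix.\<close>

lemma score_flip_difference:
  fixes \<beta> h a b B K :: real
  assumes sym: "\<And>i j. i \<in> {1..N} \<Longrightarrow> j \<in> {1..N} \<Longrightarrow> A i j = A j i"
    and diag: "\<And>i. i \<in> {1..N} \<Longrightarrow> A i i = 0"
    and K: "op_norm N A \<le> K"
    and "\<beta> > 0" and B: "\<And>x. (1 / cosh (\<beta> * x + h))\<^sup>2 * (\<bar>x\<bar> + 1) ^ 3 \<le> B"
    and ab: "\<bar>a\<bar> \<le> 1" "\<bar>b\<bar> \<le> 1"
    and i: "i \<in> {1..N}" and \<sigma>: "\<sigma> \<in> configs N"
  defines "m \<equiv> local_field N A \<sigma>"
  defines "H \<equiv> \<lambda>\<sigma>. a * score_S N A \<sigma> \<beta> h + b * score_Q N A \<sigma> \<beta> h"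
  defines "f' \<equiv> \<lambda>x. a * tanh (\<beta> * x + h) + (a * x + b) * (\<beta> * (1 / cosh (\<beta> * x + h))\<^sup>2)"
  shows "\<bar>H \<sigma> - H (flip i \<sigma>)\<bar>
    \<le> 4 * (\<bar>m i\<bar> + 1) + 2 * \<bar>\<Sum>j=1..N. A i j * f' (m j)\<bar> + 4 * ((2 * \<beta> + 2 * \<beta>\<^sup>2) * B) * K\<^sup>2"
proof -
  define g where "g = (\<lambda>x. a * x + b)"
  define f where "f = (\<lambda>x. (a * x + b) * tanh (\<beta> * x + h))"
  define m' where "m' = local_field N A (flip i \<sigma>)"
  define D where "D = (2 * \<beta> + 2 * \<beta>\<^sup>2) * B"
  define \<rho> where "\<rho> = (\<lambda>j. f (m' j) - f (m j) - f' (m j) * (m' j - m j))"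
  define y where "y = (\<Sum>j=1..N. A i j * f' (m j))"
  have m': "m' j = m j - 2 * A j i * \<sigma> i" for j
    unfolding m'_def m_def by (rule local_field_flip[OF i])
  have col: "(\<Sum>j=1..N. A j i * v j) = (\<Sum>j=1..N. A i j * v j)" for v
    by (intro sum.cong refl) (simp add: sym[OF i])
  have H_eq: "H s = (\<Sum>j=1..N. s j * g (local_field N A s j) - f (local_field N A s j))" for s
    unfolding H_def score_S_def score_Q_def sum_distrib_left sum.distrib[symmetric]
    by (intro sum.cong refl) (simp add: g_def f_def algebra_simps)
  have "H \<sigma> - H (flip i \<sigma>)
      = (\<Sum>j=1..N. 2 * a * \<sigma> i * (A j i * \<sigma> j) + 2 * \<sigma> i * (g (m' j) * of_bool (j = i))
          - 2 * \<sigma> i * (A j i * f' (m j)) + \<rho> j)"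
    unfolding H_eq m_def[symmetric] m'_def[symmetric] sum_subtractf[symmetric]
  proof (intro sum.cong refl)
    fix j
    have "f (m' j) - f (m j) = \<rho> j - 2 * \<sigma> i * (A j i * f' (m j))"
      by (simp add: \<rho>_def m')
    moreover have "\<sigma> j * g (m j) - flip i \<sigma> j * g (m' j)
        = 2 * a * \<sigma> i * (A j i * \<sigma> j) + 2 * \<sigma> i * (g (m' j) * of_bool (j = i))"
      by (simp add: flip_eq g_def m' algebra_simps)
    ultimately show "\<sigma> j * g (m j) - f (m j) - (flip i \<sigma> j * g (m' j) - f (m' j))
        = 2 * a * \<sigma> i * (A j i * \<sigma> j) + 2 * \<sigma> i * (g (m' j) * of_bool (j = i))
          - 2 * \<sigma> i * (A j i * f' (m j)) + \<rho> j"
      by linarith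
  qed
  also have "\<dots> = 2 * a * \<sigma> i * (\<Sum>j=1..N. A j i * \<sigma> j) + 2 * \<sigma> i * g (m' i)
      - 2 * \<sigma> i * (\<Sum>j=1..N. A j i * f' (m j)) + (\<Sum>j=1..N. \<rho> j)"
    by (simp only: sum.distrib sum_subtractf sum_distrib_left[symmetric] sum_times_of_bool[OF i])
  also have "(\<Sum>j=1..N. A j i * \<sigma> j) = m i"
    unfolding col m_def local_field_def ..
  also have "(\<Sum>j=1..N. A j i * f' (m j)) = y"
    unfolding col y_def ..
  also have "g (m' i) = g (m i)"
    by (simp add: m' diag[OF i])
  finally have eq: "H \<sigma> - H (flip i \<sigma>) = 2 * \<sigma> i * (a * m i) + 2 * \<sigma> i * g (m i) - 2 * \<sigma> i * y + (\<Sum>j=1..N. \<rho> j)"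
    by simp
  have s1: "\<bar>\<sigma> i\<bar> = 1"
    by (rule config_abs[OF \<sigma> i])
  have am: "\<bar>a * m i\<bar> \<le> \<bar>m i\<bar>"
    using ab by (simp add: abs_mult mult_left_le_one_le)
  have "\<bar>g (m i)\<bar> \<le> \<bar>m i\<bar> + 1"
    using am ab by (simp add: g_def)
  moreover have "\<bar>\<Sum>j=1..N. \<rho> j\<bar> \<le> 4 * D * K\<^sup>2"
  proof -
    have "\<bar>\<rho> j\<bar> \<le> 4 * D * (A j i)\<^sup>2" for j
    proof -
      have "\<bar>\<rho> j\<bar> \<le> D * (m' j - m j)\<^sup>2"
        unfolding \<rho>_def f_def f'_def D_def by (rule affine_tanh_taylor(2)[OF \<open>\<beta> > 0\<close> B ab])
      also have "(m' j - m j)\<^sup>2 = 4 * (A j i)\<^sup>2"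
        using config_square[OF \<sigma> i] by (simp add: m' power_mult_distrib)
      finally show ?thesis by simp
    qed
    then have "\<bar>\<Sum>j=1..N. \<rho> j\<bar> \<le> (\<Sum>j=1..N. 4 * D * (A j i)\<^sup>2)"
      by (intro order_trans[OF sum_abs] sum_mono) auto
    also have "\<dots> = 4 * D * (\<Sum>j=1..N. (A j i)\<^sup>2)"
      by (simp add: sum_distrib_left)
    also have "\<dots> \<le> 4 * D * K\<^sup>2"
    proof (rule mult_left_mono[OF column_sum_squares_le[OF K i]])
      have "0 \<le> B" by (rule order_trans[OF _ B[of 0]]) auto
      with \<open>\<beta> > 0\<close> show "0 \<le> 4 * D" by (simp add: D_def)
    qed
    finally show ?thesis .
  qed
  moreover have "\<bar>2 * \<sigma> i * z\<bar> = 2 * \<bar>z\<bar>" for z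
    by (simp add: abs_mult s1)
  ultimately show ?thesis
    unfolding eq y_def[symmetric] D_def[symmetric]
    using am by (smt (verit, best))
qed

text \<open>The mean of \<open>(a S + b Q)\<^sup>2\<close> is of order \<open>N\<close>.  Write \<open>H = a S + b Q = \<Sum>\<^sub>i u\<^sub>i\<close>, where \<open>u\<^sub>i\<close> is
  \<open>a m\<^sub>i + b\<close> times the residual at \<open>i\<close>.  Flipping the spin at \<open>i\<close> turns the mean of \<open>u\<^sub>i H\<close> into half the
  mean of \<open>u\<^sub>i (H \<sigma> - H (flip i \<sigma>))\<close>, and the sum over \<open>i\<close> of the latter is at most \<open>C N\<close> for every \<open>\<sigma>\<close>.\<close>

lemma score_second_moment:
  fixes \<beta> h a b B K :: real
  assumes sym: "\<And>i j. i \<in> {1..N} \<Longrightarrow> j \<in> {1..N} \<Longrightarrow> A i j = A j i"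
    and diag: "\<And>i. i \<in> {1..N} \<Longrightarrow> A i i = 0"
    and K: "op_norm N A \<le> K"
    and "\<beta> > 0" and B: "\<And>x. (1 / cosh (\<beta> * x + h))\<^sup>2 * (\<bar>x\<bar> + 1) ^ 3 \<le> B"
    and ab: "\<bar>a\<bar> \<le> 1" "\<bar>b\<bar> \<le> 1"
  defines "C \<equiv> 22 * (K\<^sup>2 + 1) + 2 * K\<^sup>2 * (1 + \<beta> * B)\<^sup>2 + (4 * ((2 * \<beta> + 2 * \<beta>\<^sup>2) * B) * K\<^sup>2)\<^sup>2"
  shows "(\<Sum>\<sigma>\<in>configs N. gibbs_weight N A \<beta> h \<sigma> *
            (a * score_S N A \<sigma> \<beta> h + b * score_Q N A \<sigma> \<beta> h)\<^sup>2)
         \<le> C / 2 * real N * partition_function N A \<beta> h"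
proof -
  define w where "w = gibbs_weight N A \<beta> h"
  define m where "m = local_field N A"
  define H where "H = (\<lambda>\<sigma>. a * score_S N A \<sigma> \<beta> h + b * score_Q N A \<sigma> \<beta> h)"
  define u where "u = (\<lambda>i \<sigma>. (a * m \<sigma> i + b) * (\<sigma> i - tanh (\<beta> * m \<sigma> i + h)))"
  define f' where "f' = (\<lambda>x. a * tanh (\<beta> * x + h) + (a * x + b) * (\<beta> * (1 / cosh (\<beta> * x + h))\<^sup>2))"
  define E where "E = 4 * ((2 * \<beta> + 2 * \<beta>\<^sup>2) * B) * K\<^sup>2"
  have H_eq: "H \<sigma> = (\<Sum>i=1..N. u i \<sigma>)" for \<sigma>
    unfolding H_def u_def m_def score_S_def score_Q_def sum_distrib_left sum.distrib[symmetric]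
    by (intro sum.cong refl) (simp add: algebra_simps)
  have m_flip: "m (flip i \<sigma>) i = m \<sigma> i" if "i \<in> {1..N}" for i \<sigma>
    unfolding m_def local_field_flip[OF that] by (simp add: diag[OF that])
  have anti: "w (flip i \<sigma>) * u i (flip i \<sigma>) = - (w \<sigma> * u i \<sigma>)"
    if "i \<in> {1..N}" "\<sigma> \<in> configs N" for i \<sigma>
  proof -
    have "w (flip i \<sigma>) * (flip i \<sigma> i - tanh (\<beta> * m \<sigma> i + h)) = - (w \<sigma> * (\<sigma> i - tanh (\<beta> * m \<sigma> i + h)))"
      unfolding w_def m_def by (rule gibbs_weight_residual_flip) (fact sym diag that)+
    then have "(a * m \<sigma> i + b) * (w (flip i \<sigma>) * (flip i \<sigma> i - tanh (\<beta> * m \<sigma> i + h)))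
        = (a * m \<sigma> i + b) * (- (w \<sigma> * (\<sigma> i - tanh (\<beta> * m \<sigma> i + h))))"
      by (rule arg_cong)
    then show ?thesis
      unfolding u_def m_flip[OF that(1)] by (simp add: mult_ac)
  qed
  have half: "(\<Sum>\<sigma>\<in>configs N. w \<sigma> * u i \<sigma> * H \<sigma>)
      = 1/2 * (\<Sum>\<sigma>\<in>configs N. w \<sigma> * (u i \<sigma> * (H \<sigma> - H (flip i \<sigma>))))"
    if i: "i \<in> {1..N}" for i
  proof -
    have "(\<Sum>\<sigma>\<in>configs N. w \<sigma> * u i \<sigma> * H \<sigma>) = (\<Sum>\<sigma>\<in>configs N. w (flip i \<sigma>) * u i (flip i \<sigma>) * H (flip i \<sigma>))"
      by (rule sum_configs_flip[OF i, symmetric])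
    also have "\<dots> = - (\<Sum>\<sigma>\<in>configs N. w \<sigma> * u i \<sigma> * H (flip i \<sigma>))"
      unfolding sum_negf[symmetric] by (intro sum.cong refl) (simp add: anti[OF i])
    finally show ?thesis
      by (simp add: right_diff_distrib sum_subtractf mult_ac)
  qed
  have pointwise: "(\<Sum>i=1..N. u i \<sigma> * (H \<sigma> - H (flip i \<sigma>))) \<le> C * real N"
    if \<sigma>: "\<sigma> \<in> configs N" for \<sigma>
  proof -
    define y where "y = (\<lambda>i. \<Sum>j=1..N. A i j * f' (m \<sigma> j))"
    have bound: "u i \<sigma> * (H \<sigma> - H (flip i \<sigma>)) \<le> 22 * (m \<sigma> i)\<^sup>2 + 2 * (y i)\<^sup>2 + (22 + E\<^sup>2)"
      if i: "i \<in> {1..N}" for i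
    proof -
      define v where "v = \<bar>m \<sigma> i\<bar> + 1"
      have \<Delta>: "\<bar>H \<sigma> - H (flip i \<sigma>)\<bar> \<le> 4 * v + 2 * \<bar>y i\<bar> + E"
        unfolding H_def v_def y_def E_def f'_def m_def
        by (rule score_flip_difference) (fact sym diag K \<open>\<beta> > 0\<close> B ab i \<sigma>)+
      have "\<bar>a * m \<sigma> i\<bar> \<le> \<bar>m \<sigma> i\<bar>"
        using ab by (simp add: abs_mult mult_left_le_one_le)
      then have "\<bar>a * m \<sigma> i + b\<bar> \<le> v"
        using ab by (simp add: v_def)
      moreover have "\<bar>\<sigma> i - tanh (\<beta> * m \<sigma> i + h)\<bar> \<le> 2"
        using config_abs[OF \<sigma> i] abs_tanh_le_1[of "\<beta> * m \<sigma> i + h"] by linarith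
      ultimately have "\<bar>u i \<sigma>\<bar> \<le> v * 2"
        unfolding u_def abs_mult by (intro mult_mono) (auto simp: v_def)
      then have "\<bar>u i \<sigma>\<bar> * \<bar>H \<sigma> - H (flip i \<sigma>)\<bar> \<le> (v * 2) * (4 * v + 2 * \<bar>y i\<bar> + E)"
        using \<Delta> by (intro mult_mono) (auto simp: v_def)
      also have "\<dots> = 8 * v\<^sup>2 + 2 * (2 * (v * \<bar>y i\<bar>)) + 2 * v * E"
        by (simp add: algebra_simps power2_eq_square)
      also have "\<dots> \<le> 8 * v\<^sup>2 + 2 * (v\<^sup>2 + (y i)\<^sup>2) + (v\<^sup>2 + E\<^sup>2)"
      proof -
        have "2 * (v * \<bar>y i\<bar>) \<le> v\<^sup>2 + (y i)\<^sup>2"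
          using sum_squares_bound[of v "\<bar>y i\<bar>"] by simp
        moreover have "2 * v * E \<le> v\<^sup>2 + E\<^sup>2"
          by (rule sum_squares_bound)
        ultimately show ?thesis
          by (intro add_mono mult_left_mono order_refl) auto
      qed
      also have "\<dots> = 11 * v\<^sup>2 + 2 * (y i)\<^sup>2 + E\<^sup>2"
        by simp
      also have "v\<^sup>2 \<le> 2 * (m \<sigma> i)\<^sup>2 + 2"
        using sum_squares_bound[of "\<bar>m \<sigma> i\<bar>" 1] by (simp add: v_def power2_sum)
      finally show ?thesis
        using abs_ge_self[of "u i \<sigma> * (H \<sigma> - H (flip i \<sigma>))"] by (simp add: abs_mult)
    qed
    have "(\<Sum>i=1..N. u i \<sigma> * (H \<sigma> - H (flip i \<sigma>)))
        \<le> (\<Sum>i=1..N. 22 * (m \<sigma> i)\<^sup>2 + 2 * (y i)\<^sup>2 + (22 + E\<^sup>2))"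
      by (intro sum_mono bound)
    also have "\<dots> = 22 * (\<Sum>i=1..N. (m \<sigma> i)\<^sup>2) + 2 * (\<Sum>i=1..N. (y i)\<^sup>2) + (22 + E\<^sup>2) * real N"
      by (simp add: sum.distrib sum_distrib_left algebra_simps)
    also have "\<dots> \<le> 22 * (K\<^sup>2 * real N) + 2 * (K\<^sup>2 * ((1 + \<beta> * B)\<^sup>2 * real N)) + (22 + E\<^sup>2) * real N"
    proof (intro add_mono mult_left_mono order_refl)
      show "(\<Sum>i=1..N. (m \<sigma> i)\<^sup>2) \<le> K\<^sup>2 * real N"
        unfolding m_def by (rule sum_local_field_squares_le[OF K \<sigma>])
      have f'_sum: "(\<Sum>j=1..N. (f' (m \<sigma> j))\<^sup>2) \<le> (\<Sum>j=1..N. (1 + \<beta> * B)\<^sup>2)"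
      proof (rule sum_mono)
        fix j
        have "\<bar>f' (m \<sigma> j)\<bar> \<le> 1 + \<beta> * B"
          unfolding f'_def by (rule affine_tanh_taylor(1)) (fact \<open>\<beta> > 0\<close> B ab)+
        from power_mono[OF this abs_ge_zero, of 2] show "(f' (m \<sigma> j))\<^sup>2 \<le> (1 + \<beta> * B)\<^sup>2"
          by simp
      qed
      have "(\<Sum>i=1..N. (y i)\<^sup>2) \<le> K\<^sup>2 * (\<Sum>j=1..N. (f' (m \<sigma> j))\<^sup>2)"
        unfolding y_def by (rule matrix_vector_sum_squares_le[OF K])
      also have "\<dots> \<le> K\<^sup>2 * (\<Sum>j=1..N. (1 + \<beta> * B)\<^sup>2)"
        using f'_sum by (rule mult_left_mono) simp
      finally show "(\<Sum>i=1..N. (y i)\<^sup>2) \<le> K\<^sup>2 * ((1 + \<beta> * B)\<^sup>2 * real N)"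
        by (simp add: mult_ac)
    qed auto
    also have "\<dots> = C * real N"
      by (simp add: C_def E_def algebra_simps)
    finally show ?thesis .
  qed
  have "(\<Sum>\<sigma>\<in>configs N. w \<sigma> * (H \<sigma>)\<^sup>2) = (\<Sum>\<sigma>\<in>configs N. \<Sum>i=1..N. w \<sigma> * u i \<sigma> * H \<sigma>)"
    by (simp add: H_eq power2_eq_square sum_distrib_left sum_distrib_right mult_ac)
  also have "\<dots> = (\<Sum>i=1..N. \<Sum>\<sigma>\<in>configs N. w \<sigma> * u i \<sigma> * H \<sigma>)"
    by (rule sum.swap)
  also have "\<dots> = (\<Sum>i=1..N. 1/2 * (\<Sum>\<sigma>\<in>configs N. w \<sigma> * (u i \<sigma> * (H \<sigma> - H (flip i \<sigma>)))))"
    by (intro sum.cong refl half)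
  also have "\<dots> = 1/2 * (\<Sum>\<sigma>\<in>configs N. \<Sum>i=1..N. w \<sigma> * (u i \<sigma> * (H \<sigma> - H (flip i \<sigma>))))"
    by (subst sum.swap) (rule sum_distrib_left[symmetric])
  also have "\<dots> = 1/2 * (\<Sum>\<sigma>\<in>configs N. w \<sigma> * (\<Sum>i=1..N. u i \<sigma> * (H \<sigma> - H (flip i \<sigma>))))"
    unfolding sum_distrib_left[symmetric] ..
  also have "\<dots> \<le> 1/2 * (\<Sum>\<sigma>\<in>configs N. w \<sigma> * (C * real N))"
    by (intro mult_left_mono sum_mono pointwise) (auto simp: w_def less_imp_le[OF gibbs_weight_pos])
  also have "\<dots> = C / 2 * real N * partition_function N A \<beta> h"
    unfolding partition_function_def w_def by (simp add: sum_distrib_right[symmetric])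
  finally show ?thesis
    by (simp only: w_def H_def)
qed

text \<open>Markov's inequality for \<open>S\<^sup>2 + Q\<^sup>2\<close>.\<close>

lemma score_tail_bound:
  fixes \<beta> h B K L :: real
  assumes sym: "\<And>i j. i \<in> {1..N} \<Longrightarrow> j \<in> {1..N} \<Longrightarrow> A i j = A j i"
    and diag: "\<And>i. i \<in> {1..N} \<Longrightarrow> A i i = 0"
    and K: "op_norm N A \<le> K"
    and "\<beta> > 0" and B: "\<And>x. (1 / cosh (\<beta> * x + h))\<^sup>2 * (\<bar>x\<bar> + 1) ^ 3 \<le> B"
    and N: "N \<ge> 1" and L: "L > 0"
  defines "C \<equiv> 22 * (K\<^sup>2 + 1) + 2 * K\<^sup>2 * (1 + \<beta> * B)\<^sup>2 + (4 * ((2 * \<beta> + 2 * \<beta>\<^sup>2) * B) * K\<^sup>2)\<^sup>2"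
  shows "measure (gibbs N A \<beta> h)
      {\<sigma> \<in> configs N. (score_S N A \<sigma> \<beta> h)\<^sup>2 + (score_Q N A \<sigma> \<beta> h)\<^sup>2 > L\<^sup>2 * real N} \<le> C / L\<^sup>2"
proof -
  define w where "w = gibbs_weight N A \<beta> h"
  define Z where "Z = partition_function N A \<beta> h"
  define G where "G = (\<lambda>\<sigma>. (score_S N A \<sigma> \<beta> h)\<^sup>2 + (score_Q N A \<sigma> \<beta> h)\<^sup>2)"
  define bad where "bad = {\<sigma> \<in> configs N. G \<sigma> > L\<^sup>2 * real N}"
  have w0: "0 \<le> w \<sigma>" for \<sigma>
    by (simp add: w_def less_imp_le[OF gibbs_weight_pos])
  have Z0: "Z > 0"
    by (simp add: Z_def partition_function_pos)
  have "(\<Sum>\<sigma>\<in>configs N. w \<sigma> * (score_S N A \<sigma> \<beta> h)\<^sup>2) \<le> C / 2 * real N * Z"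
    using score_second_moment[where a=1 and b=0, OF sym diag K \<open>\<beta> > 0\<close> B]
    by (simp add: w_def Z_def C_def)
  moreover have "(\<Sum>\<sigma>\<in>configs N. w \<sigma> * (score_Q N A \<sigma> \<beta> h)\<^sup>2) \<le> C / 2 * real N * Z"
    using score_second_moment[where a=0 and b=1, OF sym diag K \<open>\<beta> > 0\<close> B]
    by (simp add: w_def Z_def C_def)
  ultimately have mean: "(\<Sum>\<sigma>\<in>configs N. w \<sigma> * G \<sigma>) \<le> C * real N * Z"
    by (simp add: G_def distrib_left sum.distrib)
  have "(\<Sum>\<sigma>\<in>bad. w \<sigma>) * (L\<^sup>2 * real N) = (\<Sum>\<sigma>\<in>bad. w \<sigma> * (L\<^sup>2 * real N))"
    by (rule sum_distrib_right)
  also have "\<dots> \<le> (\<Sum>\<sigma>\<in>bad. w \<sigma> * G \<sigma>)"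
    by (intro sum_mono mult_left_mono w0) (auto simp: bad_def)
  also have "\<dots> \<le> (\<Sum>\<sigma>\<in>configs N. w \<sigma> * G \<sigma>)"
    by (intro sum_mono2) (auto simp: bad_def w0 G_def)
  also note mean
  finally have "(\<Sum>\<sigma>\<in>bad. w \<sigma>) * L\<^sup>2 \<le> C * Z"
    using N by (simp add: mult_ac)
  then have "(\<Sum>\<sigma>\<in>bad. w \<sigma>) / Z \<le> C / L\<^sup>2"
    using L Z0 by (simp add: field_simps)
  moreover have "measure (gibbs N A \<beta> h) bad = (\<Sum>\<sigma>\<in>bad. w \<sigma>) / Z"
    unfolding w_def Z_def by (rule measure_gibbs) (auto simp: bad_def)
  ultimately show ?thesis
    by (simp add: bad_def G_def)
qed

section \<open>Existence, uniqueness and location of the root\<close>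

text \<open>Minus the logarithm of the pseudolikelihood, up to the additive constant \<open>N ln 2\<close>.\<close>

definition neg_log_pl ::
    "nat \<Rightarrow> (nat \<Rightarrow> nat \<Rightarrow> real) \<Rightarrow> (nat \<Rightarrow> real) \<Rightarrow> real \<Rightarrow> real \<Rightarrow> real" where
  "neg_log_pl N A \<sigma> \<beta> h =
     (\<Sum>i=1..N. ln (cosh (\<beta> * local_field N A \<sigma> i + h)) - \<sigma> i * (\<beta> * local_field N A \<sigma> i + h))"

lemma neg_log_pl_directional_derivative:
  "((\<lambda>t. neg_log_pl N A \<sigma> (\<beta> + t * a) (h + t * b)) has_real_derivative
      - (a * score_S N A \<sigma> (\<beta> + t * a) (h + t * b) + b * score_Q N A \<sigma> (\<beta> + t * a) (h + t * b))) (at t)"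
proof -
  define m where "m = local_field N A \<sigma>"
  have "((\<lambda>t. \<Sum>i=1..N. ln (cosh ((\<beta> + t * a) * m i + (h + t * b)))
            - \<sigma> i * ((\<beta> + t * a) * m i + (h + t * b))) has_real_derivative
      (\<Sum>i=1..N. (tanh ((\<beta> + t * a) * m i + (h + t * b)) - \<sigma> i) * (a * m i + b))) (at t)"
    by (auto intro!: derivative_eq_intros DERIV_sum simp: tanh_def algebra_simps add_divide_distrib)
  moreover have "(\<Sum>i=1..N. (tanh ((\<beta> + t * a) * m i + (h + t * b)) - \<sigma> i) * (a * m i + b))
      = - (a * score_S N A \<sigma> (\<beta> + t * a) (h + t * b) + b * score_Q N A \<sigma> (\<beta> + t * a) (h + t * b))"
    unfolding score_S_def score_Q_def m_def[symmetric] sum_distrib_left sum.distrib[symmetric] sum_negf[symmetric]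
    by (intro sum.cong refl) (simp add: algebra_simps)
  ultimately show ?thesis
    by (simp add: neg_log_pl_def m_def)
qed

lemma continuous_on_neg_log_pl: "continuous_on S (\<lambda>(\<beta>, h). neg_log_pl N A \<sigma> \<beta> h)"
  unfolding neg_log_pl_def split_beta
  by (intro continuous_intros) auto

text \<open>If the gradient of \<^const>\<open>neg_log_pl\<close> points outwards on a circle, then the minimum over the
  closed disc is attained in its interior and is a root of the score equations.\<close>

lemma score_root_in_disc:
  assumes r: "r > 0"
    and outward: "\<And>a b. a\<^sup>2 + b\<^sup>2 = r\<^sup>2 \<Longrightarrow>
       a * score_S N A \<sigma> (\<beta> + a) (h + b) + b * score_Q N A \<sigma> (\<beta> + a) (h + b) < 0"
  obtains p where "score_root N A \<sigma> p" "norm (p - (\<beta>, h)) \<le> r"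
proof -
  define D where "D = cball (\<beta>, h) r"
  have D_iff: "(\<beta> + a, h + b) \<in> D \<longleftrightarrow> a\<^sup>2 + b\<^sup>2 \<le> r\<^sup>2" for a b
  proof -
    have "(\<beta> + a, h + b) \<in> D \<longleftrightarrow> sqrt (a\<^sup>2 + b\<^sup>2) \<le> r"
      by (simp add: D_def dist_norm norm_Pair)
    also have "\<dots> \<longleftrightarrow> a\<^sup>2 + b\<^sup>2 \<le> r\<^sup>2"
      using r by (auto intro: sqrt_le_D real_le_lsqrt)
    finally show ?thesis .
  qed
  have D: "compact D" "D \<noteq> {}"
    using r by (auto simp: D_def)
  obtain p where p: "p \<in> D" and min: "\<forall>q\<in>D.
      (\<lambda>(\<beta>, h). neg_log_pl N A \<sigma> \<beta> h) p \<le> (\<lambda>(\<beta>, h). neg_log_pl N A \<sigma> \<beta> h) q"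
    using continuous_attains_inf[OF D continuous_on_neg_log_pl[of D N A \<sigma>]] by (elim bexE)
  obtain a b where ab: "p = (\<beta> + a, h + b)"
    by (rule that[of "fst p - \<beta>" "snd p - h"]) simp
  have le: "a\<^sup>2 + b\<^sup>2 \<le> r\<^sup>2"
    using p D_iff by (simp add: ab)
  have min': "neg_log_pl N A \<sigma> (\<beta> + a) (h + b) \<le> neg_log_pl N A \<sigma> (\<beta> + a') (h + b')"
    if "a'\<^sup>2 + b'\<^sup>2 \<le> r\<^sup>2" for a' b'
    using bspec[OF min, of "(\<beta> + a', h + b')"] that by (simp add: D_iff ab)
  have "a\<^sup>2 + b\<^sup>2 \<noteq> r\<^sup>2"
  proof
    assume eq: "a\<^sup>2 + b\<^sup>2 = r\<^sup>2"
    \<comment> \<open>moving from \<open>p\<close> towards the centre decreases the function\<close>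
    define \<phi> where "\<phi> = (\<lambda>t. neg_log_pl N A \<sigma> (\<beta> + a + t * (- a)) (h + b + t * (- b)))"
    have "(\<phi> has_real_derivative
        a * score_S N A \<sigma> (\<beta> + a) (h + b) + b * score_Q N A \<sigma> (\<beta> + a) (h + b)) (at 0)"
      unfolding \<phi>_def using neg_log_pl_directional_derivative[of N A \<sigma> "\<beta> + a" "- a" "h + b" "- b" 0]
      by (simp add: add.commute)
    from DERIV_neg_dec_right[OF this outward[OF eq]]
    obtain d where d: "d > 0" "\<And>t. 0 < t \<Longrightarrow> t < d \<Longrightarrow> \<phi> t < \<phi> 0"
      by auto
    define t where "t = min (d / 2) 1"
    have t: "0 < t" "t < d" "t \<le> 1"
      using d(1) by (auto simp: t_def)
    have "(a * (1 - t))\<^sup>2 + (b * (1 - t))\<^sup>2 = (1 - t)\<^sup>2 * r\<^sup>2"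
      by (simp add: power_mult_distrib distrib_left mult.commute flip: eq)
    also have "\<dots> \<le> r\<^sup>2"
      using t by (intro mult_left_le_one_le) (auto simp: power_le_one)
    finally have "\<phi> 0 \<le> \<phi> t"
      using min'[of "a * (1 - t)" "b * (1 - t)"] by (simp add: \<phi>_def algebra_simps)
    with d(2)[OF t(1,2)] show False by simp
  qed
  with le have less: "a\<^sup>2 + b\<^sup>2 < r\<^sup>2" by simp
  have stationary: "u * score_S N A \<sigma> (\<beta> + a) (h + b) + v * score_Q N A \<sigma> (\<beta> + a) (h + b) = 0" for u v
  proof -
    define \<phi> where "\<phi> = (\<lambda>t. neg_log_pl N A \<sigma> (\<beta> + a + t * u) (h + b + t * v))"
    have deriv: "(\<phi> has_real_derivative
        - (u * score_S N A \<sigma> (\<beta> + a) (h + b) + v * score_Q N A \<sigma> (\<beta> + a) (h + b))) (at 0)"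
      unfolding \<phi>_def using neg_log_pl_directional_derivative[of N A \<sigma> "\<beta> + a" u "h + b" v 0]
      by simp
    have "((\<lambda>t. (a + t * u)\<^sup>2 + (b + t * v)\<^sup>2) \<longlongrightarrow> (a + 0 * u)\<^sup>2 + (b + 0 * v)\<^sup>2) (at 0)"
      by (intro tendsto_intros)
    then have "\<forall>\<^sub>F t in at 0. (a + t * u)\<^sup>2 + (b + t * v)\<^sup>2 < r\<^sup>2"
      using less by (intro order_tendstoD(2)[where y = "(a + 0 * u)\<^sup>2 + (b + 0 * v)\<^sup>2"]) auto
    then obtain d where d: "d > 0"
        "\<And>t. t \<noteq> 0 \<Longrightarrow> \<bar>t\<bar> < d \<Longrightarrow> (a + t * u)\<^sup>2 + (b + t * v)\<^sup>2 < r\<^sup>2"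
      unfolding eventually_at dist_real_def diff_0_right by blast
    have local_min: "\<phi> 0 \<le> \<phi> t" if "\<bar>0 - t\<bar> < d" for t
    proof (cases "t = 0")
      case False
      then show ?thesis
        using min'[of "a + t * u" "b + t * v"] d(2)[of t] that
        by (simp add: \<phi>_def add.assoc)
    qed simp
    have "- (u * score_S N A \<sigma> (\<beta> + a) (h + b) + v * score_Q N A \<sigma> (\<beta> + a) (h + b)) = 0"
      using local_min by (intro DERIV_local_min[OF deriv d(1)]) simp
    then show ?thesis by simp
  qed
  show ?thesis
  proof
    show "score_root N A \<sigma> p"
      using stationary[of 1 0] stationary[of 0 1] by (simp add: score_root_def ab)
    show "norm (p - (\<beta>, h)) \<le> r"
      using p by (simp add: D_def dist_norm norm_minus_commute)
  qed
qed

lemma T_tilde_pos_imp_nonconstant: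
  assumes "T_tilde N A \<sigma> \<beta> h > 0"
  obtains i j where "i \<in> {1..N}" "j \<in> {1..N}" "local_field N A \<sigma> i \<noteq> local_field N A \<sigma> j"
proof -
  have "\<exists>i\<in>{1..N}. \<exists>j\<in>{1..N}. local_field N A \<sigma> i \<noteq> local_field N A \<sigma> j"
  proof (rule ccontr)
    assume "\<not> ?thesis"
    then have const: "local_field N A \<sigma> i = local_field N A \<sigma> j" if "i \<in> {1..N}" "j \<in> {1..N}" for i j
      using that by blast
    have "(local_field N A \<sigma> i - local_field N A \<sigma> j)\<^sup>2 = 0" if "i \<in> {1..N}" "j \<in> {1..N}" for i j
      unfolding const[OF that] by simp
    then have "(\<Sum>i=1..N. \<Sum>j=1..N. theta N A \<sigma> \<beta> h i * theta N A \<sigma> \<beta> h j *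
        (local_field N A \<sigma> i - local_field N A \<sigma> j)\<^sup>2) = 0"
      by (intro sum.neutral ballI) (simp only: mult_zero_right)
    then have "T_tilde N A \<sigma> \<beta> h = 0"
      by (simp only: T_tilde_def mult_zero_right)
    with assms show False by simp
  qed
  with that show ?thesis by blast
qed

text \<open>Strict concavity of the log-pseudolikelihood: between two roots the increments of \<open>tanh\<close> pair to zero with the increments
  of its arguments, so all arguments coincide; two distinct local fields then determine the point.\<close>

lemma score_root_unique:
  assumes p: "score_root N A \<sigma> (\<beta>, h)" "score_root N A \<sigma> (\<beta>', h')"
    and ij: "i \<in> {1..N}" "j \<in> {1..N}" "local_field N A \<sigma> i \<noteq> local_field N A \<sigma> j"
  shows "(\<beta>, h) = (\<beta>', h')"
proof -
  define m where "m = local_field N A \<sigma>"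
  define x where "x = (\<lambda>i. \<beta> * m i + h)"
  define x' where "x' = (\<lambda>i. \<beta>' * m i + h')"
  have nonneg: "0 \<le> (tanh (x k) - tanh (x' k)) * (x k - x' k)" for k
    by (cases "x k \<le> x' k") (auto intro: mult_nonneg_nonneg mult_nonpos_nonpos)
  have "(\<Sum>k=1..N. (tanh (x k) - tanh (x' k)) * (x k - x' k))
      = (\<beta> - \<beta>') * (score_S N A \<sigma> \<beta>' h' - score_S N A \<sigma> \<beta> h)
        + (h - h') * (score_Q N A \<sigma> \<beta>' h' - score_Q N A \<sigma> \<beta> h)"
    unfolding score_S_def score_Q_def sum_subtractf[symmetric] sum_distrib_left sum.distrib[symmetric]
    by (intro sum.cong refl) (simp add: x_def x'_def m_def algebra_simps)
  also have "\<dots> = 0"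
    using p by (simp add: score_root_def)
  finally have "(tanh (x k) - tanh (x' k)) * (x k - x' k) = 0" if "k \<in> {1..N}" for k
    using that sum_nonneg_eq_0_iff[of "{1..N}" "\<lambda>k. (tanh (x k) - tanh (x' k)) * (x k - x' k)"] nonneg
    by simp
  then have "x k = x' k" if "k \<in> {1..N}" for k
    using that tanh_real_eq_iff[of "x k" "x' k"] by simp
  from this[OF ij(1)] this[OF ij(2)]
  have e: "\<beta> * m i + h = \<beta>' * m i + h'" "\<beta> * m j + h = \<beta>' * m j + h'"
    by (auto simp: x_def x'_def)
  then have "(\<beta> - \<beta>') * (m i - m j) = 0"
    by (simp add: algebra_simps)
  then have "\<beta> = \<beta>'"
    using ij(3) by (simp add: m_def)
  with e show ?thesis by simp
qed

text \<open>The information matrix at \<open>(\<beta>, h)\<close> has determinant \<open>N\<^sup>2 T / 2\<close>, where \<open>T\<close> is \<^const>\<open>T_tilde\<close>, and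
  trace at most \<open>B N\<close>; for a positive semidefinite \<open>2 \<times> 2\<close> matrix the smallest eigenvalue is at
  least the determinant divided by the trace.\<close>

lemma information_form_lower:
  fixes a b c B :: real
  assumes B: "B > 0" "\<And>x. (1 / cosh (\<beta> * x + h))\<^sup>2 * (\<bar>x\<bar> + 1) ^ 3 \<le> B"
    and N: "N \<ge> 1" and T: "T_tilde N A \<sigma> \<beta> h \<ge> c"
  shows "(\<Sum>i=1..N. theta N A \<sigma> \<beta> h i * (a * local_field N A \<sigma> i + b)\<^sup>2)
    \<ge> c / (2 * B) * real N * (a\<^sup>2 + b\<^sup>2)"
proof -
  define m where "m = local_field N A \<sigma>"
  define \<theta> where "\<theta> = theta N A \<sigma> \<beta> h"
  define P where "P = (\<Sum>i=1..N. \<theta> i * (m i)\<^sup>2)"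
  define R where "R = (\<Sum>i=1..N. \<theta> i * m i)"
  define D where "D = (\<Sum>i=1..N. \<theta> i)"
  define q where "q = (\<Sum>i=1..N. \<theta> i * (a * m i + b)\<^sup>2)"
  have \<theta>0: "0 \<le> \<theta> i" for i
    by (simp add: \<theta>_def theta_def)
  have q_eq: "q = a\<^sup>2 * P + 2 * a * b * R + b\<^sup>2 * D"
    unfolding q_def P_def R_def D_def sum_distrib_left sum.distrib[symmetric]
    by (intro sum.cong refl) (simp add: algebra_simps power2_eq_square)
  have q0: "0 \<le> q"
    unfolding q_def by (intro sum_nonneg mult_nonneg_nonneg \<theta>0) auto
  have "(\<Sum>i=1..N. \<Sum>j=1..N. \<theta> i * \<theta> j * (m i - m j)\<^sup>2)
      = (\<Sum>i=1..N. \<theta> i * (m i)\<^sup>2 * D + \<theta> i * P - 2 * (\<theta> i * m i) * R)"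
    unfolding P_def R_def D_def sum_distrib_left sum.distrib[symmetric] sum_subtractf[symmetric]
    by (intro sum.cong refl) (simp add: algebra_simps power2_eq_square)
  also have "\<dots> = P * D + D * P - 2 * R * R"
    by (simp only: sum.distrib sum_subtractf sum_distrib_left[symmetric] sum_distrib_right[symmetric]
        P_def[symmetric] R_def[symmetric] D_def[symmetric])
  finally have det: "(real N)\<^sup>2 * T_tilde N A \<sigma> \<beta> h = 2 * (P * D - R\<^sup>2)"
    using N unfolding T_tilde_def m_def[symmetric] \<theta>_def[symmetric]
    by (simp add: power2_eq_square)
  have trace: "P + D \<le> B * real N"
  proof -
    have "\<theta> i * (m i)\<^sup>2 + \<theta> i \<le> B" for i
    proof -
      have "(m i)\<^sup>2 + 1 \<le> (\<bar>m i\<bar> + 1) ^ 2"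
        by (simp add: power2_sum)
      also have "\<dots> \<le> (\<bar>m i\<bar> + 1) ^ 3"
        by (intro power_increasing) auto
      finally have "\<theta> i * ((m i)\<^sup>2 + 1) \<le> \<theta> i * (\<bar>m i\<bar> + 1) ^ 3"
        by (intro mult_left_mono \<theta>0)
      also have "\<dots> \<le> B"
        using B(2)[of "m i"] by (simp only: \<theta>_def theta_def m_def)
      finally show ?thesis
        by (simp add: distrib_left)
    qed
    then have "P + D \<le> (\<Sum>i=1..N. B)"
      unfolding P_def D_def sum.distrib[symmetric] by (intro sum_mono)
    then show ?thesis by (simp add: mult.commute)
  qed
  have "(P * D - R\<^sup>2) * (a\<^sup>2 + b\<^sup>2) \<le> (P * D - R\<^sup>2) * (a\<^sup>2 + b\<^sup>2) + (a * P + b * R)\<^sup>2 + (b * D + a * R)\<^sup>2"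
    by simp
  also have "\<dots> = (P + D) * q"
    unfolding q_eq by (simp add: algebra_simps power2_eq_square)
  also have "\<dots> \<le> (B * real N) * q"
    by (intro mult_right_mono trace q0)
  finally have "2 * ((P * D - R\<^sup>2) * (a\<^sup>2 + b\<^sup>2)) \<le> 2 * (B * real N * q)"
    by (rule mult_left_mono) simp
  then have "(real N)\<^sup>2 * T_tilde N A \<sigma> \<beta> h * (a\<^sup>2 + b\<^sup>2) \<le> 2 * (B * real N * q)"
    unfolding det by (simp only: mult.assoc)
  moreover have "(real N)\<^sup>2 * c * (a\<^sup>2 + b\<^sup>2) \<le> (real N)\<^sup>2 * T_tilde N A \<sigma> \<beta> h * (a\<^sup>2 + b\<^sup>2)"
    by (intro mult_right_mono mult_left_mono T) auto
  ultimately have "real N * (real N * c * (a\<^sup>2 + b\<^sup>2)) \<le> real N * (2 * B * q)"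
    by (simp add: power2_eq_square mult_ac)
  then have "real N * c * (a\<^sup>2 + b\<^sup>2) \<le> 2 * B * q"
    using N by simp
  then have "c / (2 * B) * real N * (a\<^sup>2 + b\<^sup>2) \<le> q"
    using B(1) by (simp add: field_simps)
  then show ?thesis
    by (simp only: q_def m_def \<theta>_def)
qed

text \<open>The decrease of the score along a displacement \<open>(a, b)\<close> of length \<open>r\<close>.  The displacement of each
  argument of \<open>tanh\<close> is at most \<open>r (\<bar>m\<^sub>i\<bar> + 1)\<close>, so the cubic error is absorbed by \<open>sech\<^sup>2\<close>.\<close>

lemma score_decrease:
  fixes a b c r B :: real
  assumes B: "B > 0" "\<And>x. (1 / cosh (\<beta> * x + h))\<^sup>2 * (\<bar>x\<bar> + 1) ^ 3 \<le> B"
    and N: "N \<ge> 1" and T: "T_tilde N A \<sigma> \<beta> h \<ge> c"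
    and r: "r > 0" "a\<^sup>2 + b\<^sup>2 = r\<^sup>2"
  shows "a * score_S N A \<sigma> (\<beta> + a) (h + b) + b * score_Q N A \<sigma> (\<beta> + a) (h + b)
    \<le> a * score_S N A \<sigma> \<beta> h + b * score_Q N A \<sigma> \<beta> h - (c / (2 * B) - r * B) * real N * r\<^sup>2"
proof -
  define m where "m = local_field N A \<sigma>"
  define \<theta> where "\<theta> = theta N A \<sigma> \<beta> h"
  define x where "x = (\<lambda>i. \<beta> * m i + h)"
  define d where "d = (\<lambda>i. a * m i + b)"
  have \<theta>0: "0 \<le> \<theta> i" for i
    by (simp add: \<theta>_def theta_def)
  have \<theta>_eq: "\<theta> i = (1 / cosh (x i))\<^sup>2" for i
    by (simp add: \<theta>_def theta_def x_def m_def)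
  have "\<bar>a\<bar> \<le> r" "\<bar>b\<bar> \<le> r"
    using abs_le_square_iff[of a r] abs_le_square_iff[of b r] r(1) by (auto simp flip: r(2))
  then have dr: "\<bar>d i\<bar> \<le> r * (\<bar>m i\<bar> + 1)" for i
    using mult_right_mono[of "\<bar>a\<bar>" r "\<bar>m i\<bar>"] abs_triangle_ineq[of "a * m i" b]
    by (simp add: d_def distrib_left abs_mult)
  have term_lower: "\<theta> i * (d i)\<^sup>2 - r ^ 3 * B \<le> (tanh (x i + d i) - tanh (x i)) * d i" for i
  proof -
    have "\<theta> i * \<bar>d i\<bar> ^ 3 \<le> \<theta> i * (r * (\<bar>m i\<bar> + 1)) ^ 3"
      by (intro mult_left_mono power_mono dr \<theta>0) auto
    also have "\<dots> = r ^ 3 * (\<theta> i * (\<bar>m i\<bar> + 1) ^ 3)"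
      by (simp only: power_mult_distrib mult_ac)
    also have "\<dots> \<le> r ^ 3 * B"
      using r(1) B(2)[of "m i"] by (intro mult_left_mono) (auto simp only: \<theta>_eq x_def, auto)
    finally have "\<theta> i * \<bar>d i\<bar> ^ 3 \<le> r ^ 3 * B" .
    moreover have "\<theta> i * (d i)\<^sup>2 * (1 - \<bar>d i\<bar>) \<le> (tanh (x i + d i) - tanh (x i)) * d i"
      unfolding \<theta>_eq by (rule tanh_increment_lower)
    moreover have "\<theta> i * (d i)\<^sup>2 * (1 - \<bar>d i\<bar>) = \<theta> i * (d i)\<^sup>2 - \<theta> i * \<bar>d i\<bar> ^ 3"
    proof -
      have "\<bar>d i\<bar> ^ 3 = (d i)\<^sup>2 * \<bar>d i\<bar>"
        by (simp add: power3_eq_cube power2_eq_square)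
      then show ?thesis
        by (simp add: right_diff_distrib)
    qed
    ultimately show ?thesis by linarith
  qed
  have "c / (2 * B) * real N * r\<^sup>2 - real N * (r ^ 3 * B) \<le> (\<Sum>i=1..N. \<theta> i * (d i)\<^sup>2) - real N * (r ^ 3 * B)"
    using information_form_lower[OF B N T, of a b] unfolding r(2) \<theta>_def d_def m_def by simp
  also have "\<dots> = (\<Sum>i=1..N. \<theta> i * (d i)\<^sup>2 - r ^ 3 * B)"
    by (simp add: sum_subtractf)
  also have "\<dots> \<le> (\<Sum>i=1..N. (tanh (x i + d i) - tanh (x i)) * d i)"
    by (intro sum_mono term_lower)
  also have "\<dots> = a * (score_S N A \<sigma> \<beta> h - score_S N A \<sigma> (\<beta> + a) (h + b))
      + b * (score_Q N A \<sigma> \<beta> h - score_Q N A \<sigma> (\<beta> + a) (h + b))"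
    unfolding score_S_def score_Q_def sum_subtractf[symmetric] sum_distrib_left sum.distrib[symmetric]
    by (intro sum.cong refl) (simp add: x_def d_def m_def algebra_simps)
  finally show ?thesis
    by (simp add: algebra_simps power2_eq_square power3_eq_cube)
qed

text \<open>The deterministic part of the argument: on a circle of radius \<open>M / sqrt N\<close> the decrease of the score
  beats its value at the centre, so the unique root lies inside.\<close>

lemma mple_near:
  fixes c L M B :: real
  assumes B: "B > 0" "\<And>x. (1 / cosh (\<beta> * x + h))\<^sup>2 * (\<bar>x\<bar> + 1) ^ 3 \<le> B"
    and N: "N \<ge> 1" and c: "c > 0" and T: "T_tilde N A \<sigma> \<beta> h \<ge> c"
    and L: "L \<ge> 0" "(score_S N A \<sigma> \<beta> h)\<^sup>2 + (score_Q N A \<sigma> \<beta> h)\<^sup>2 \<le> L\<^sup>2 * real N"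
    and M: "M > 0" "L < (c / (2 * B) - M / sqrt N * B) * M"
  shows "mple_exists N A \<sigma> \<and> norm (mple N A \<sigma> - (\<beta>, h)) \<le> M / sqrt N"
proof -
  define r where "r = M / sqrt N"
  have r: "r > 0" using M N by (simp add: r_def)
  have outward: "a * score_S N A \<sigma> (\<beta> + a) (h + b) + b * score_Q N A \<sigma> (\<beta> + a) (h + b) < 0"
    if ab: "a\<^sup>2 + b\<^sup>2 = r\<^sup>2" for a b
  proof -
    define S where "S = score_S N A \<sigma> \<beta> h"
    define Q where "Q = score_Q N A \<sigma> \<beta> h"
    have "(a * S + b * Q)\<^sup>2 \<le> (a * S + b * Q)\<^sup>2 + (a * Q - b * S)\<^sup>2"
      by simp
    also have "\<dots> = (a\<^sup>2 + b\<^sup>2) * (S\<^sup>2 + Q\<^sup>2)"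
      by (simp add: algebra_simps power2_eq_square)
    also have "\<dots> \<le> r\<^sup>2 * (L\<^sup>2 * real N)"
      unfolding ab using L(2) by (intro mult_left_mono) (auto simp: S_def Q_def)
    also have "\<dots> = (L * M)\<^sup>2"
      using N by (simp add: r_def power_divide power_mult_distrib)
    finally have "a * S + b * Q \<le> L * M"
      by (rule power2_le_imp_le) (use L(1) M(1) in simp)
    also have "\<dots> < (c / (2 * B) - r * B) * M * M"
      using M by (intro mult_strict_right_mono) (auto simp: r_def)
    also have "\<dots> = (c / (2 * B) - r * B) * real N * r\<^sup>2"
      using N by (simp add: r_def power_divide power2_eq_square)
    finally show ?thesis
      using score_decrease[OF B N T r ab] by (simp add: S_def Q_def)
  qed
  obtain p where p: "score_root N A \<sigma> p" "norm (p - (\<beta>, h)) \<le> r"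
    using score_root_in_disc[OF r outward] by blast
  have "T_tilde N A \<sigma> \<beta> h > 0" using T c by simp
  then obtain i j where ij: "i \<in> {1..N}" "j \<in> {1..N}" "local_field N A \<sigma> i \<noteq> local_field N A \<sigma> j"
    by (rule T_tilde_pos_imp_nonconstant)
  have uniq: "q = p" if "score_root N A \<sigma> q" for q
    using score_root_unique[OF _ _ ij, of "fst q" "snd q" "fst p" "snd p"] that p(1) by simp
  have "mple N A \<sigma> = p"
    unfolding mple_def using p(1) uniq by (rule the_equality)
  moreover have "mple_exists N A \<sigma>"
    unfolding mple_exists_def using p(1) uniq by blast
  ultimately show ?thesis
    using p(2) by (simp add: r_def)
qed

section \<open>Root-\<open>N\<close> consistency\<close>

lemma prob_space_gibbs: "prob_space (gibbs N A \<beta> h)"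
  unfolding gibbs_def
proof (rule prob_space_point_measure)
  have "(\<Sum>\<sigma>\<in>configs N. gibbs_weight N A \<beta> h \<sigma> / partition_function N A \<beta> h) = 1"
    using partition_function_pos[of N A \<beta> h]
    by (simp flip: sum_divide_distrib partition_function_def)
  then show "(\<Sum>\<sigma>\<in>configs N. ennreal (gibbs_weight N A \<beta> h \<sigma> / partition_function N A \<beta> h)) = 1"
    by (subst sum_ennreal)
      (auto simp: less_imp_le[OF gibbs_weight_pos] less_imp_le[OF partition_function_pos])
qed auto

lemma sets_gibbs: "sets (gibbs N A \<beta> h) = Pow (configs N)"
  by (simp add: gibbs_def sets_point_measure)

theorem theorem1p1:
  fixes J :: "nat \<Rightarrow> nat \<Rightarrow> nat \<Rightarrow> real" and \<beta>\<^sub>0 h\<^sub>0 :: real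
  assumes symmetric: "\<And>N i j. i \<in> {1..N} \<Longrightarrow> j \<in> {1..N} \<Longrightarrow> J N i j = J N j i"
    and zero_diagonal: "\<And>N i. i \<in> {1..N} \<Longrightarrow> J N i i = 0"
    and beta_pos: "\<beta>\<^sub>0 > 0"
    and norm_bounded: "bdd_above ((\<lambda>N. op_norm N (J N)) ` {1..})"
    and T_tilde_Omega_p:
      "\<And>\<epsilon>::real. \<epsilon> > 0 \<Longrightarrow> \<exists>c>0. \<forall>\<^sub>F N in sequentially.
         measure (gibbs N (J N) \<beta>\<^sub>0 h\<^sub>0) {\<tau> \<in> configs N. T_tilde N (J N) \<tau> \<beta>\<^sub>0 h\<^sub>0 \<ge> c} \<ge> 1 - \<epsilon>"
  shows "((\<lambda>N. measure (gibbs N (J N) \<beta>\<^sub>0 h\<^sub>0) {\<tau> \<in> configs N. mple_exists N (J N) \<tau>})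
            \<longlonglongrightarrow> 1)
       \<and> (\<forall>\<epsilon>>0. \<exists>M::real. \<forall>\<^sub>F N in sequentially.
            measure (gibbs N (J N) \<beta>\<^sub>0 h\<^sub>0)
              {\<tau> \<in> configs N. mple_exists N (J N) \<tau> \<and>
                 norm (mple N (J N) \<tau> - (\<beta>\<^sub>0, h\<^sub>0)) \<le> M * real N powr (-1/2)} \<ge> 1 - \<epsilon>)"
proof -
  define \<mu> where "\<mu> = (\<lambda>N. gibbs N (J N) \<beta>\<^sub>0 h\<^sub>0)"
  define good where "good = (\<lambda>M N. {\<tau> \<in> configs N. mple_exists N (J N) \<tau> \<and>
                 norm (mple N (J N) \<tau> - (\<beta>\<^sub>0, h\<^sub>0)) \<le> M * real N powr (-1/2)})"
  obtain K where "\<And>N. N \<in> {1..} \<Longrightarrow> op_norm N (J N) \<le> K"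
    using norm_bounded unfolding bdd_above_def by auto
  then have K: "op_norm N (J N) \<le> K" if "N \<ge> 1" for N
    using that by simp
  obtain B where B: "B > 0" "\<And>x. (1 / cosh (\<beta>\<^sub>0 * x + h\<^sub>0))\<^sup>2 * (\<bar>x\<bar> + 1) ^ 3 \<le> B"
    using sech_sq_times_cube_bounded[OF beta_pos, of h\<^sub>0] by blast
  define C where "C = 22 * (K\<^sup>2 + 1) + 2 * K\<^sup>2 * (1 + \<beta>\<^sub>0 * B)\<^sup>2
      + (4 * ((2 * \<beta>\<^sub>0 + 2 * \<beta>\<^sub>0\<^sup>2) * B) * K\<^sup>2)\<^sup>2"
  have C: "C > 0"
    unfolding C_def by (intro add_pos_nonneg) (auto simp: add_nonneg_pos)
  have consistent: "\<exists>M. \<forall>\<^sub>F N in sequentially. measure (\<mu> N) (good M N) \<ge> 1 - \<epsilon>"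
    if \<epsilon>: "\<epsilon> > 0" for \<epsilon> :: real
  proof -
    obtain c where c: "c > 0" and ev: "\<forall>\<^sub>F N in sequentially.
        measure (\<mu> N) {\<tau> \<in> configs N. T_tilde N (J N) \<tau> \<beta>\<^sub>0 h\<^sub>0 \<ge> c} \<ge> 1 - \<epsilon> / 2"
      using T_tilde_Omega_p[of "\<epsilon> / 2"] \<epsilon> unfolding \<mu>_def by auto
    define L where "L = sqrt (2 * C / \<epsilon>)"
    define \<kappa> where "\<kappa> = c / (2 * B)"
    \<comment> \<open>chosen so that \<open>L < \<kappa> / 2 * M\<close>\<close>
    define M where "M = 2 * L / \<kappa> + 1"
    have L: "L > 0" "C / L\<^sup>2 = \<epsilon> / 2"
      using C \<epsilon> by (auto simp: L_def field_simps)
    have \<kappa>: "\<kappa> > 0" using c B by (simp add: \<kappa>_def)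
    have M: "M > 0" "L < \<kappa> / 2 * M"
      using L \<kappa> by (auto simp: M_def field_simps add_pos_pos)
    have "\<forall>\<^sub>F N in sequentially. N \<ge> max 1 (nat \<lceil>(2 * M * B / \<kappa>)\<^sup>2\<rceil>)"
      by (rule eventually_ge_at_top)
    with ev have "\<forall>\<^sub>F N in sequentially. measure (\<mu> N) (good M N) \<ge> 1 - \<epsilon>"
    proof eventually_elim
      case (elim N)
      interpret prob_space "\<mu> N"
        unfolding \<mu>_def by (rule prob_space_gibbs)
      have N: "N \<ge> 1" and "(2 * M * B / \<kappa>)\<^sup>2 \<le> real N"
        using elim(2) by linarith+
      then have "2 * M * B / \<kappa> \<le> sqrt N"
        by (intro real_le_rsqrt)
      then have "M / sqrt N * B \<le> \<kappa> / 2"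
        using N \<kappa> by (simp add: field_simps)
      then have "\<kappa> / 2 * M \<le> (\<kappa> - M / sqrt N * B) * M"
        using M by (intro mult_right_mono) auto
      with M have LM: "L < (c / (2 * B) - M / sqrt N * B) * M"
        by (simp add: \<kappa>_def)
      define bad where "bad = {\<sigma> \<in> configs N.
        (score_S N (J N) \<sigma> \<beta>\<^sub>0 h\<^sub>0)\<^sup>2 + (score_Q N (J N) \<sigma> \<beta>\<^sub>0 h\<^sub>0)\<^sup>2 > L\<^sup>2 * real N}"
      have "measure (\<mu> N) bad \<le> C / L\<^sup>2"
        unfolding \<mu>_def bad_def C_def
        by (rule score_tail_bound[OF symmetric zero_diagonal K[OF N] beta_pos B(2) N L(1)])
      then have "measure (\<mu> N) bad \<le> \<epsilon> / 2"
        by (simp only: L(2))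
      moreover have "{\<tau> \<in> configs N. T_tilde N (J N) \<tau> \<beta>\<^sub>0 h\<^sub>0 \<ge> c} \<subseteq> good M N \<union> bad"
      proof
        fix \<tau> assume \<tau>: "\<tau> \<in> {\<tau> \<in> configs N. T_tilde N (J N) \<tau> \<beta>\<^sub>0 h\<^sub>0 \<ge> c}"
        show "\<tau> \<in> good M N \<union> bad"
        proof (cases "\<tau> \<in> bad")
          case False
          then have "mple_exists N (J N) \<tau> \<and> norm (mple N (J N) \<tau> - (\<beta>\<^sub>0, h\<^sub>0)) \<le> M / sqrt N"
            using \<tau> L(1) M(1)
            by (intro mple_near[OF B N c _ _ _ _ LM]) (auto simp: bad_def)
          moreover have "M / sqrt N = M * real N powr (-1/2)"
            using powr_minus_divide[of "real N" "1/2"] by (simp add: powr_half_sqrt)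
          ultimately show ?thesis
            using \<tau> by (simp add: good_def)
        qed simp
      qed
      then have "measure (\<mu> N) {\<tau> \<in> configs N. T_tilde N (J N) \<tau> \<beta>\<^sub>0 h\<^sub>0 \<ge> c} \<le> measure (\<mu> N) (good M N \<union> bad)"
        by (rule finite_measure_mono) (auto simp: \<mu>_def sets_gibbs good_def bad_def)
      moreover have "measure (\<mu> N) (good M N \<union> bad) \<le> measure (\<mu> N) (good M N) + measure (\<mu> N) bad"
        by (rule measure_Un_le) (auto simp: \<mu>_def sets_gibbs good_def bad_def)
      ultimately show ?case
        using elim(1) by linarith
    qed
    then show ?thesis by blast
  qed
  have "(\<lambda>N. measure (\<mu> N) {\<tau> \<in> configs N. mple_exists N (J N) \<tau>}) \<longlonglongrightarrow> 1"
  proof (rule order_tendstoI)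
    fix y :: real assume "1 < y"
    then show "\<forall>\<^sub>F N in sequentially. measure (\<mu> N) {\<tau> \<in> configs N. mple_exists N (J N) \<tau>} < y"
      by (intro always_eventually allI order.strict_trans1[OF prob_space.prob_le_1])
        (auto simp: \<mu>_def prob_space_gibbs)
  next
    fix y :: real assume y: "y < 1"
    then obtain M where "\<forall>\<^sub>F N in sequentially. measure (\<mu> N) (good M N) \<ge> 1 - (1 - y) / 2"
      using consistent[of "(1 - y) / 2"] by auto
    then show "\<forall>\<^sub>F N in sequentially. y < measure (\<mu> N) {\<tau> \<in> configs N. mple_exists N (J N) \<tau>}"
    proof eventually_elim
      case (elim N)
      interpret prob_space "\<mu> N"
        unfolding \<mu>_def by (rule prob_space_gibbs)
      have "measure (\<mu> N) (good M N) \<le> measure (\<mu> N) {\<tau> \<in> configs N. mple_exists N (J N) \<tau>}"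
        by (rule finite_measure_mono) (auto simp: \<mu>_def sets_gibbs good_def)
      with elim y show ?case by (simp add: field_simps)
    qed
  qed
  with consistent show ?thesis
    unfolding \<mu>_def good_def by blast
qed

end
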